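(* There exists a universal constant $C\in(0,1]$ such that the following holds. Let $\mu$ be the Lebesgue measure on $\mathbb R$, $n\ge3$, and let $\overline S$ be the set of all probability densities of the form $t=f\mathbf 1_{(\overline x,+\infty)}$ where $\overline x\in\mathbb R$ and $f$ is a non-negative, non-increasing function on $(\overline x,+\infty)$ with $\int_{\overline x}^{+\infty}f(x)\,dx=1$. Then any $\rho$-estimator $\widehat s$ on $\overline S$ satisfies $$C\,\mathbb E_s\left[h^2(s,\widehat s)\right]\le\inf_{D\ge1}\left[h^2\left(s,\overline V(D)\cap\overline S\right)+\frac Dn\log_+^3\left(\frac nD\right)\right]\quad\text{for all }s\in\mathscr L_\mu,$$ where the infimum is over integers $D\ge 1$.
   Context: Setting. $\mu$ is the Lebesgue measure on $\mathbb R$ and $\mathscr L_\mu$ is the set of probability densities on $\mathbb R$ with respect to $\mu$. The Hellinger distance is $h(t,u)=\left[\frac12\int(\sqrt t-\sqrt u)^2d\mu\right]^{1/2}$, and $h(t,A)=\inf_{u\in A}h(t,u)$ for $A\subset\mathscr L_\mu$. One observes i.i.d. random variables $X_1,\dots,X_n$ ($n\ge3$) with density $s\in\mathscr L_\mu$; $\mathbb E_s$ is the expectation when the true density is $s$. $\log_+(x)=\max\{\log x,1\}$. For an integer $D\ge1$, $\overline V(D)$ is the set of all densities of the form $\sum_{j=1}^Da_j\mathbf 1_{(x_j,x_{j+1}]}$ with $x_1<x_2<\dots<x_{D+1}$ real and $a_j\ge0$. $\rho$-estimators. Let $\psi(u)=\frac{u-1}{\sqrt{1+u^2}}$ for $u\in[0,+\infty)$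 and $\psi(+\infty)=1$. For densities $t,t'$ put $$\mathbf T(\boldsymbol X,t,t')=\frac n2\left[h^2\left(t,\tfrac{t+t'}2\right)-h^2\left(t',\tfrac{t+t'}2\right)\right]+\frac1{\sqrt2}\sum_{i=1}^n\psi\left(\sqrt{\tfrac{t'}{t}(X_i)}\right),$$ with the conventions $0/0=1$ and $a/0=+\infty$ for $a>0$. Given an at most countable subset $S$ of $\overline S$ which is dense in $\overline S$ for the Hellinger distance, let $\boldsymbol\Upsilon(S,t)=\sup_{t'\in S}\mathbf T(\boldsymbol X,t,t')$. A $\rho$-estimator on $\overline S$ is any (measurable) element $\widehat s$ of the closure (for $h$) of $\{t\in S:\ \boldsymbol\Upsilon(S,t)\le\inf_{t'\in S}\boldsymbol\Upsilon(S,t')+35.7\}$. *)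

theory Defs
  imports "HOL-Probability.Probability"
begin

definition densities :: "(real \<Rightarrow> real) set" where
  "densities = {t. t \<in> borel_measurable borel \<and> (\<forall>x. 0 \<le> t x) \<and>
                   (\<integral>\<^sup>+x. ennreal (t x) \<partial>lborel) = 1}"

definition hellinger :: "(real \<Rightarrow> real) \<Rightarrow> (real \<Rightarrow> real) \<Rightarrow> real" where
  "hellinger t u = sqrt (1 / 2 * (LINT x|lborel. (sqrt (t x) - sqrt (u x))\<^sup>2))"

definition hellinger_set :: "(real \<Rightarrow> real) \<Rightarrow> (real \<Rightarrow> real) set \<Rightarrow> real" where
  "hellinger_set t A = (INF u\<in>A. hellinger t u)"

text \<open>Densities are functions, not almost-everywhere classes, so \<^const>\<open>hellinger\<close> is only a
  pseudometric on \<^const>\<open>densities\<close>; closure, density and the Borel sets are those of the induced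
  topology on \<^const>\<open>densities\<close>.\<close>

definition hellinger_closure :: "(real \<Rightarrow> real) set \<Rightarrow> (real \<Rightarrow> real) set" where
  "hellinger_closure A = {t \<in> densities. \<forall>e>0. \<exists>u\<in>A. hellinger t u < e}"

definition hellinger_open :: "(real \<Rightarrow> real) set \<Rightarrow> bool" where
  "hellinger_open U \<longleftrightarrow> U \<subseteq> densities \<and>
     (\<forall>t\<in>U. \<exists>e>0. \<forall>u\<in>densities. hellinger t u < e \<longrightarrow> u \<in> U)"

definition hellinger_borel :: "(real \<Rightarrow> real) measure" where
  "hellinger_borel = sigma densities {U. hellinger_open U}"

definition log_plus :: "real \<Rightarrow> real" where
  "log_plus x = max (ln x) 1"

definition step_densities :: "nat \<Rightarrow> (real \<Rightarrow> real) set" where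
  "step_densities D = {t \<in> densities. \<exists>(x :: nat \<Rightarrow> real) (a :: nat \<Rightarrow> real).
     strict_mono_on {1..D + 1} x \<and> (\<forall>j\<in>{1..D}. 0 \<le> a j) \<and>
     t = (\<lambda>y. \<Sum>j=1..D. a j * indicator {x j<..x (j + 1)} y)}"

definition decreasing_densities :: "(real \<Rightarrow> real) set" where
  "decreasing_densities = {t \<in> densities. \<exists>(x0 :: real) (f :: real \<Rightarrow> real).
     (\<forall>y\<in>{x0<..}. 0 \<le> f y) \<and> antimono_on {x0<..} f \<and>
     (LINT y:{x0<..}|lborel. f y) = 1 \<and>
     t = (\<lambda>y. f y * indicator {x0<..} y)}"

definition psi :: "ereal \<Rightarrow> real" where
  "psi u = (if u = \<infinity> then 1 else (real_of_ereal u - 1) / sqrt (1 + (real_of_ereal u)\<^sup>2))"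

text \<open>The square root of \<open>a / b\<close> for \<open>a, b \<ge> 0\<close>, with the conventions \<open>0 / 0 = 1\<close> and
  \<open>a / 0 = \<infinity>\<close> for \<open>a > 0\<close>.\<close>

definition sqrt_ratio :: "real \<Rightarrow> real \<Rightarrow> ereal" where
  "sqrt_ratio a b = (if b = 0 then (if a = 0 then 1 else \<infinity>) else ereal (sqrt (a / b)))"

definition rho_T :: "nat \<Rightarrow> (nat \<Rightarrow> real) \<Rightarrow> (real \<Rightarrow> real) \<Rightarrow> (real \<Rightarrow> real) \<Rightarrow> real" where
  "rho_T n X t t' =
     real n / 2 * ((hellinger t (\<lambda>x. (t x + t' x) / 2))\<^sup>2 - (hellinger t' (\<lambda>x. (t x + t' x) / 2))\<^sup>2)
     + 1 / sqrt 2 * (\<Sum>i=1..n. psi (sqrt_ratio (t' (X i)) (t (X i))))"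

text \<open>The supremum and the infimum below are over bounded sets of reals, since
  \<open>\<bar>rho_T n X t t'\<bar> \<le> n / 2 + n / sqrt 2\<close> for all densities.\<close>

definition rho_Upsilon :: "nat \<Rightarrow> (nat \<Rightarrow> real) \<Rightarrow> (real \<Rightarrow> real) set \<Rightarrow> (real \<Rightarrow> real) \<Rightarrow> real" where
  "rho_Upsilon n X S t = (SUP t'\<in>S. rho_T n X t t')"

definition rho_near_minimizers :: "nat \<Rightarrow> (nat \<Rightarrow> real) \<Rightarrow> (real \<Rightarrow> real) set \<Rightarrow> (real \<Rightarrow> real) set" where
  "rho_near_minimizers n X S =
     {t \<in> S. rho_Upsilon n X S t \<le> (INF t'\<in>S. rho_Upsilon n X S t') + 35.7}"

text \<open>An estimator is a map from the sample space \<open>\<real>\<^sup>n\<close>, represented by the extensional functions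
  on \<open>{1..n}\<close>, to densities. The countable dense set \<open>S\<close> is arbitrary.\<close>

definition rho_estimator ::
    "nat \<Rightarrow> (real \<Rightarrow> real) set \<Rightarrow> ((nat \<Rightarrow> real) \<Rightarrow> (real \<Rightarrow> real)) \<Rightarrow> bool" where
  "rho_estimator n Sbar shat \<longleftrightarrow>
     (\<exists>S. countable S \<and> S \<subseteq> Sbar \<and> Sbar \<subseteq> hellinger_closure S \<and>
          shat \<in> measurable (Pi\<^sub>M {1..n} (\<lambda>_. borel)) hellinger_borel \<and>
          (\<forall>X\<in>space (Pi\<^sub>M {1..n} (\<lambda>_. borel)).
             shat X \<in> hellinger_closure (rho_near_minimizers n X S)))"

definition sample_law :: "nat \<Rightarrow> (real \<Rightarrow> real) \<Rightarrow> (nat \<Rightarrow> real) measure" where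
  "sample_law n s = Pi\<^sub>M {1..n} (\<lambda>_. density lborel (\<lambda>x. ennreal (s x)))"

end

theory Submission
  imports Defs
begin

text \<open>
  Fix a decreasing step density \<open>v\<close> with \<open>D \<le> n\<close> pieces. Against \<open>v\<close>, the score \<open>psi (sqrt (t / v))\<close> of any
  \<open>t\<close> in the model is antitone on each of at most \<open>6 D\<close> intervals, so all its level sets are unions of
  at most \<open>6 D\<close> intervals. After splitting the line into \<open>n\<close> cells of mass \<open>1 / n\<close>, such unions are
  sandwiched between members of a finite class of log-cardinality of order \<open>D log (n / D)\<close>, and
  Chernoff's inequality with a union bound gives, with \<open>y\<close> of order \<open>(D / n) log (n / D)\<close>, relative
  deviations \<open>P\<^sub>n A \<le> (1 + l) P A + y / l\<close> and \<open>P\<^sub>n A \<ge> (1 - l) P A - y / l\<close> for all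
  \<open>l \<in> (0, 1]\<close> at once. Integrating them over the level \<open>u\<close> with \<open>l\<close> proportional to \<open>u + \<delta>\<close> bounds the
  deviation of the mean score by a small multiple of its second moment plus a term of order
  \<open>y log (1 / \<delta>)\<close>. The second moment is absorbed by the Hellinger terms in the expectation of the
  test statistic.

  The density \<open>v\<close> need not lie in the countable set \<open>S\<close>; it is a limit of elements \<open>u m\<close> of \<open>S\<close>,
  almost everywhere convergent, and \<open>rho_T n X (u m)\<close> is asymptotically at most \<open>rho_T n X v\<close>
  uniformly in the second argument.
\<close>

subsection \<open>The score function\<close>

text \<open>\<open>score a b\<close> is \<open>psi (sqrt (b / a))\<close>; the convention \<open>0 / 0 = 1\<close> inside \<open>psi\<close> agrees with the
  junk value \<open>0 / 0 = 0\<close> here.\<close>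

definition score :: "real \<Rightarrow> real \<Rightarrow> real" where
  "score a b = (sqrt b - sqrt a) / sqrt (a + b)"

lemma psi_sqrt_ratio:
  assumes "0 \<le> a" "0 \<le> b"
  shows "psi (sqrt_ratio b a) = score a b"
proof (cases "a = 0")
  case True
  then show ?thesis
    using assms by (auto simp: psi_def sqrt_ratio_def score_def one_ereal_def)
next
  case False
  with assms have a: "a > 0" by simp
  have "1 + (sqrt (b / a))\<^sup>2 = (a + b) / a"
    using a assms by (simp add: field_simps)
  then have "sqrt (1 + (sqrt (b / a))\<^sup>2) = sqrt (a + b) / sqrt a"
    by (simp add: real_sqrt_divide)
  moreover have "sqrt (b / a) - 1 = (sqrt b - sqrt a) / sqrt a"
    using a by (simp add: real_sqrt_divide diff_divide_distrib)
  ultimately show ?thesis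
    using a by (simp add: psi_def sqrt_ratio_def score_def)
qed

lemma score_swap: "score b a = - score a b"
  by (simp add: score_def add.commute minus_divide_left)

lemma abs_score_le_1:
  assumes "0 \<le> a" "0 \<le> b"
  shows "\<bar>score a b\<bar> \<le> 1"
proof (cases "a + b = 0")
  case False
  then have "a + b > 0" using assms by linarith
  moreover have "\<bar>sqrt b - sqrt a\<bar> \<le> sqrt (a + b)"
    using assms real_sqrt_le_mono[of b "a + b"] real_sqrt_le_mono[of a "a + b"]
      real_sqrt_ge_zero[of a] real_sqrt_ge_zero[of b]
    unfolding abs_le_iff by linarith
  ultimately show ?thesis by (simp add: score_def)
qed (simp add: score_def)

text \<open>For positive arguments \<open>score a b\<close> is the value of the increasing function
  \<open>(v - 1) / sqrt (1 + v^2)\<close> at \<open>v = sqrt (b / a)\<close>. Zero arguments are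
  treated apart: \<open>score a 0 = - 1\<close> is minimal when \<open>a > 0\<close>, and
  \<open>score 0 b\<close> jumps from 0 to 1.\<close>

lemma score_mono:
  assumes "0 \<le> a" "0 \<le> b" "b \<le> c"
  shows "score a b \<le> score a c"
proof (cases "b = 0 \<or> c = 0 \<or> a = 0")
  case True
  then have "b = c \<or> a = 0 \<or> (a > 0 \<and> b = 0)"
    using assms by auto
  moreover have "score a 0 = - 1" if "a > 0"
    using that by (simp add: score_def)
  moreover have "score 0 b \<le> score 0 c"
    using assms by (cases "b = 0") (auto simp: score_def)
  ultimately show ?thesis
    using abs_score_le_1[of a c] assms by auto
next
  case False
  then have p: "a > 0" "b > 0" "c > 0" using assms by auto
  define x y z where "x = sqrt a" and "y = sqrt b" and "z = sqrt c"
  have xyz: "x > 0" "y > 0" "z > 0" "y \<le> z" "a = x\<^sup>2" "b = y\<^sup>2" "c = z\<^sup>2"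
    using p assms by (auto simp: x_def y_def z_def)
  have psi_eq: "score a d = psi (ereal (sqrt (d / a)))" if "d > 0" for d
    using psi_sqrt_ratio[of a d] p that by (simp add: sqrt_ratio_def)
  have der: "((\<lambda>v::real. (v - 1) / sqrt (1 + v\<^sup>2)) has_real_derivative
        (1 + v) / (sqrt (1 + v\<^sup>2) * (1 + v\<^sup>2))) (at v)" for v
  proof -
    have q: "1 + v\<^sup>2 > 0" by (simp add: add_pos_nonneg)
    then have s: "sqrt (1 + v\<^sup>2) * sqrt (1 + v\<^sup>2) = 1 + v\<^sup>2" by simp
    show ?thesis
      apply (rule derivative_eq_intros refl | use q in \<open>simp; fail\<close>)+
      using q s by (simp add: field_simps power2_eq_square)
  qed
  have "(sqrt (b/a) - 1) / sqrt (1 + (sqrt (b/a))\<^sup>2) \<le> (sqrt (c/a) - 1) / sqrt (1 + (sqrt (c/a))\<^sup>2)"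
  proof (rule DERIV_nonneg_imp_nondecreasing[where f = "\<lambda>v. (v - 1) / sqrt (1 + v\<^sup>2)"])
    show "sqrt (b/a) \<le> sqrt (c/a)" using p assms by (simp add: divide_right_mono)
    fix v assume "sqrt (b/a) \<le> v"
    then have "0 \<le> v" using p by (meson divide_nonneg_nonneg less_eq_real_def order_trans real_sqrt_ge_zero)
    then show "\<exists>y. ((\<lambda>v. (v - 1) / sqrt (1 + v\<^sup>2)) has_real_derivative y) (at v) \<and> 0 \<le> y"
      using der by (intro exI[of _ "(1 + v) / (sqrt (1 + v\<^sup>2) * (1 + v\<^sup>2))"]) auto
  qed
  then show ?thesis using psi_eq[of b] psi_eq[of c] p by (simp add: psi_def)
qed

text \<open>The map \<open>p \<mapsto> sqrt (p^2 + c)\<close> is a contraction. For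
  \<open>a \<le> b\<close>, squaring reduces the claim to
  \<open>sqrt a \<le> sqrt (a + c)\<close>.\<close>

lemma abs_sqrt_add_diff_le:
  assumes "0 \<le> a" "0 \<le> b" "0 \<le> c"
  shows "\<bar>sqrt (a + c) - sqrt (b + c)\<bar> \<le> \<bar>sqrt a - sqrt b\<bar>"
  using assms
proof (induction a b rule: linorder_wlog)
  case (le a b)
  have "sqrt (b + c) \<le> sqrt (a + c) + (sqrt b - sqrt a)"
  proof (rule real_le_lsqrt)
    have "a * (sqrt b - sqrt a)\<^sup>2 \<le> (a + c) * (sqrt b - sqrt a)\<^sup>2"
      using le by (intro mult_right_mono) auto
    then have "sqrt a * (sqrt b - sqrt a) \<le> sqrt (a + c) * (sqrt b - sqrt a)"
      using le by (intro mult_right_mono) auto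
    moreover have "b + c = (a + c) + (sqrt b - sqrt a)\<^sup>2 + 2 * (sqrt a * (sqrt b - sqrt a))"
      using le by (simp add: power2_eq_square algebra_simps)
    moreover have "(sqrt (a + c) + (sqrt b - sqrt a))\<^sup>2
        = (a + c) + (sqrt b - sqrt a)\<^sup>2 + 2 * (sqrt (a + c) * (sqrt b - sqrt a))"
      using le by (simp add: power2_sum)
    ultimately show "b + c \<le> (sqrt (a + c) + (sqrt b - sqrt a))\<^sup>2" by linarith
  qed (use le in \<open>auto\<close>)
  then show ?case using le by (simp add: abs_if)
next
  case (sym a b)
  then show ?case by (simp add: abs_minus_commute)
qed

text \<open>Multiply by \<open>R = sqrt (a + b)\<close>: numerator and denominator each move by at
  most \<open>\<bar>sqrt a' - sqrt a\<bar>\<close>, the latter weighted by a score of modulus at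
  most 1. Since \<open>sqrt a \<le> R\<close>, the error is free of \<open>b\<close>.\<close>

lemma score_perturb_pos:
  assumes "0 < a" "0 \<le> a'" "0 \<le> b"
  shows "score a' b \<le> score a b + 2 * \<bar>sqrt a' - sqrt a\<bar> / sqrt a"
proof -
  define R R' where "R = sqrt (a + b)" and "R' = sqrt (a' + b)"
  have R: "R > 0" "sqrt a \<le> R" using assms by (auto simp: R_def)
  have R': "R' \<ge> 0" using assms by (auto simp: R'_def)
  have d: "\<bar>R' - R\<bar> \<le> \<bar>sqrt a' - sqrt a\<bar>"
    using abs_sqrt_add_diff_le[of a' a b] assms by (simp add: R_def R'_def)
  have "R * score a' b \<le> (sqrt b - sqrt a) + 2 * \<bar>sqrt a' - sqrt a\<bar>"
  proof -
    have "R' * score a' b = sqrt b - sqrt a'"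
    proof (cases "R' = 0")
      case True
      then have "a' = 0" "b = 0" using assms by (auto simp: R'_def)
      then show ?thesis by (simp add: score_def)
    qed (simp add: score_def R'_def)
    then have "R * score a' b = (R - R') * score a' b + sqrt b - sqrt a'"
      by (simp add: algebra_simps)
    moreover have "(R - R') * score a' b \<le> \<bar>R - R'\<bar> * 1"
    proof -
      have "(R - R') * score a' b \<le> \<bar>R - R'\<bar> * \<bar>score a' b\<bar>"
        by (metis abs_ge_self abs_mult)
      also have "\<dots> \<le> \<bar>R - R'\<bar> * 1"
        using assms by (intro mult_left_mono abs_score_le_1) auto
      finally show ?thesis .
    qed
    moreover have "\<bar>R - R'\<bar> - sqrt a' \<le> 2 * \<bar>sqrt a' - sqrt a\<bar> - sqrt a"
      using d abs_ge_self[of "sqrt a - sqrt a'"] by (simp add: abs_minus_commute)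
    ultimately show ?thesis by argo
  qed
  then have "score a' b \<le> ((sqrt b - sqrt a) + 2 * \<bar>sqrt a' - sqrt a\<bar>) / R"
    using R by (simp add: field_simps)
  also have "\<dots> = score a b + 2 * \<bar>sqrt a' - sqrt a\<bar> / R"
    by (simp add: score_def R_def add_divide_distrib)
  also have "\<dots> \<le> score a b + 2 * \<bar>sqrt a' - sqrt a\<bar> / sqrt a"
    using R assms by (intro add_left_mono divide_left_mono) auto
  finally show ?thesis .
qed

lemma score_le_score_0:
  assumes "0 \<le> a" "0 \<le> b"
  shows "score a b \<le> score 0 b"
  using assms abs_score_le_1[of a b] by (cases "b = 0") (auto simp: score_def)

text \<open>At \<open>a = 0\<close> the score is discontinuous, but \<open>score 0 b\<close>
  dominates every \<open>score (f m) b\<close>, so upper semicontinuity survives. The threshold for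
  \<open>m\<close> is common to all \<open>b\<close>, as a supremum over densities requires.\<close>

lemma score_eventually_le:
  assumes "a \<ge> 0" "\<And>m. f m \<ge> 0" "f \<longlonglongrightarrow> a" "e > 0"
  shows "eventually (\<lambda>m. \<forall>b\<ge>0. score (f m) b \<le> score a b + e) sequentially"
proof (cases "a = 0")
  case True
  then show ?thesis
    using assms score_le_score_0 by (intro always_eventually) (smt (verit))
next
  case False
  then have a: "a > 0" using assms by simp
  have "(\<lambda>m. 2 * \<bar>sqrt (f m) - sqrt a\<bar> / sqrt a) \<longlonglongrightarrow> 2 * \<bar>sqrt a - sqrt a\<bar> / sqrt a"
    using a by (intro tendsto_intros assms) auto
  then have "(\<lambda>m. 2 * \<bar>sqrt (f m) - sqrt a\<bar> / sqrt a) \<longlonglongrightarrow> 0" by simp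
  then have "eventually (\<lambda>m. 2 * \<bar>sqrt (f m) - sqrt a\<bar> / sqrt a < e) sequentially"
    using assms(4) by (rule order_tendstoD)
  then show ?thesis
    by eventually_elim (use a assms score_perturb_pos in \<open>smt (verit)\<close>)
qed

lemma borel_measurable_score[measurable]:
  assumes [measurable]: "f \<in> borel_measurable M" "g \<in> borel_measurable M"
  shows "(\<lambda>x. score (f x) (g x)) \<in> borel_measurable M"
  unfolding score_def by measurable

subsection \<open>Hellinger distance\<close>

lemma densitiesD:
  assumes "t \<in> densities"
  shows "t \<in> borel_measurable borel" "\<And>x. 0 \<le> t x" "integrable lborel t" "(LINT x|lborel. t x) = 1"
proof -
  show m: "t \<in> borel_measurable borel" and p: "\<And>x. 0 \<le> t x"
    using assms by (auto simp: densities_def)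
  have i: "(\<integral>\<^sup>+x. ennreal (t x) \<partial>lborel) = ennreal 1"
    using assms by (auto simp: densities_def)
  show "integrable lborel t"
    using m p i by (intro integrableI_nonneg) auto
  show "(LINT x|lborel. t x) = 1"
    using m p i by (subst integral_eq_nn_integral) auto
qed

lemma density_midpoint:
  assumes "t \<in> densities" "u \<in> densities"
  shows "(\<lambda>x. (t x + u x) / 2) \<in> densities"
proof -
  note t = densitiesD[OF assms(1)] and u = densitiesD[OF assms(2)]
  note [measurable] = t(1) u(1)
  have "(\<integral>\<^sup>+x. ennreal ((t x + u x) / 2) \<partial>lborel) = ennreal (LINT x|lborel. (t x + u x) / 2)"
    using t u by (intro nn_integral_eq_integral) auto
  then show ?thesis
    using t u by (auto simp: densities_def)
qed

lemma integrable_sqrt_diff_sq: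
  assumes "t \<in> densities" "u \<in> densities"
  shows "integrable lborel (\<lambda>x. (sqrt (t x) - sqrt (u x))\<^sup>2)"
proof (rule Bochner_Integration.integrable_bound[where f = "\<lambda>x. t x + u x"])
  note t = densitiesD[OF assms(1)] and u = densitiesD[OF assms(2)]
  note [measurable] = t(1) u(1)
  show "integrable lborel (\<lambda>x. t x + u x)" using t u by auto
  show "(\<lambda>x. (sqrt (t x) - sqrt (u x))\<^sup>2) \<in> borel_measurable lborel" by measurable
  show "AE x in lborel. norm ((sqrt (t x) - sqrt (u x))\<^sup>2) \<le> norm (t x + u x)"
  proof (intro AE_I2)
    fix x
    have "(sqrt (t x) - sqrt (u x))\<^sup>2 \<le> t x + u x"
      using t(2)[of x] u(2)[of x] by (simp add: power2_diff)
    then show "norm ((sqrt (t x) - sqrt (u x))\<^sup>2) \<le> norm (t x + u x)"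
      using t(2)[of x] u(2)[of x] by simp
  qed
qed

lemma hellinger_sq:
  "(hellinger t u)\<^sup>2 = 1 / 2 * (LINT x|lborel. (sqrt (t x) - sqrt (u x))\<^sup>2)"
  unfolding hellinger_def by (intro real_sqrt_pow2) simp

lemma hellinger_nonneg: "0 \<le> hellinger t u"
  unfolding hellinger_def by (auto intro!: real_sqrt_ge_zero)

lemma hellinger_commute: "hellinger t u = hellinger u t"
  unfolding hellinger_def by (simp add: power2_commute)

lemma hellinger_sq_le_1:
  assumes "t \<in> densities" "u \<in> densities"
  shows "(hellinger t u)\<^sup>2 \<le> 1"
proof -
  note t = densitiesD[OF assms(1)] and u = densitiesD[OF assms(2)]
  have "(LINT x|lborel. (sqrt (t x) - sqrt (u x))\<^sup>2) \<le> (LINT x|lborel. t x + u x)"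
    using t u integrable_sqrt_diff_sq[OF assms] by (intro integral_mono) (auto simp: power2_diff)
  then show ?thesis using t u by (simp add: hellinger_sq)
qed

text \<open>Young's inequality \<open>2 p q \<le> \<theta> p^2 + q^2 / \<theta>\<close>, used
  pointwise and integrated. The weight \<theta> stays free: 1 gives a triangle inequality for
  squares, a small value gives continuity of \<open>midpoint_gap\<close>.\<close>

lemma hellinger_sq_perturb:
  assumes t: "t \<in> densities" and u: "u \<in> densities" and t': "t' \<in> densities" and u': "u' \<in> densities"
    and v: "v \<in> densities" and v': "v' \<in> densities" and th: "0 < \<theta>"
    and le: "\<And>x. \<bar>(sqrt (t' x) - sqrt (u' x)) - (sqrt (t x) - sqrt (u x))\<bar> \<le> c * \<bar>sqrt (v x) - sqrt (v' x)\<bar>"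
  shows "(hellinger t' u')\<^sup>2 \<le> (1 + \<theta>) * (hellinger t u)\<^sup>2 + (1 + 1 / \<theta>) * c\<^sup>2 * (hellinger v v')\<^sup>2"
proof -
  have "(sqrt (t' x) - sqrt (u' x))\<^sup>2 \<le> (1 + \<theta>) * (sqrt (t x) - sqrt (u x))\<^sup>2
     + (1 + 1 / \<theta>) * c\<^sup>2 * (sqrt (v x) - sqrt (v' x))\<^sup>2" for x
  proof -
    define p q where "p = sqrt (t x) - sqrt (u x)" and "q = (sqrt (t' x) - sqrt (u' x)) - p"
    have "2 * p * q \<le> \<theta> * p\<^sup>2 + q\<^sup>2 / \<theta>"
    proof -
      have "0 \<le> (\<theta> * p - q)\<^sup>2 / \<theta>" using th by simp
      also have "\<dots> = \<theta> * p\<^sup>2 + q\<^sup>2 / \<theta> - 2 * p * q"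
        using th by (simp add: power2_eq_square field_simps)
      finally show ?thesis by simp
    qed
    then have "(p + q)\<^sup>2 \<le> (1 + \<theta>) * p\<^sup>2 + (1 + 1 / \<theta>) * q\<^sup>2"
      by (simp add: power2_sum algebra_simps)
    also have "q\<^sup>2 \<le> (c * (sqrt (v x) - sqrt (v' x)))\<^sup>2"
    proof -
      have "\<bar>q\<bar> \<le> c * \<bar>sqrt (v x) - sqrt (v' x)\<bar>" using le[of x] by (simp add: q_def p_def)
      then have "\<bar>q\<bar>\<^sup>2 \<le> (c * \<bar>sqrt (v x) - sqrt (v' x)\<bar>)\<^sup>2" by (intro power_mono) auto
      then show ?thesis by (simp add: power_mult_distrib)
    qed
    finally have "(p + q)\<^sup>2 \<le> (1 + \<theta>) * p\<^sup>2 + (1 + 1 / \<theta>) * (c * (sqrt (v x) - sqrt (v' x)))\<^sup>2"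
      using th by (simp add: mult_left_mono)
    then show ?thesis by (simp add: p_def q_def power_mult_distrib mult.assoc)
  qed
  then have "(LINT x|lborel. (sqrt (t' x) - sqrt (u' x))\<^sup>2) \<le> (LINT x|lborel.
      (1 + \<theta>) * (sqrt (t x) - sqrt (u x))\<^sup>2 + (1 + 1 / \<theta>) * c\<^sup>2 * (sqrt (v x) - sqrt (v' x))\<^sup>2)"
    using assms integrable_sqrt_diff_sq by (intro integral_mono) auto
  also have "\<dots> = (1 + \<theta>) * (LINT x|lborel. (sqrt (t x) - sqrt (u x))\<^sup>2)
     + (1 + 1 / \<theta>) * c\<^sup>2 * (LINT x|lborel. (sqrt (v x) - sqrt (v' x))\<^sup>2)"
    using assms integrable_sqrt_diff_sq by (subst Bochner_Integration.integral_add) auto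
  finally show ?thesis by (simp add: hellinger_sq)
qed

lemma hellinger_sq_triangle:
  assumes "t \<in> densities" "u \<in> densities" "v \<in> densities"
  shows "(hellinger t v)\<^sup>2 \<le> 2 * (hellinger t u)\<^sup>2 + 2 * (hellinger u v)\<^sup>2"
  using hellinger_sq_perturb[OF assms(1,2,1,3,2,3), of 1 1] by simp

lemma abs_sqrt_midpoint_diff_le:
  assumes "0 \<le> a" "0 \<le> b" "0 \<le> c"
  shows "\<bar>sqrt ((a + c) / 2) - sqrt ((b + c) / 2)\<bar> \<le> \<bar>sqrt a - sqrt b\<bar>"
proof -
  have "\<bar>sqrt ((a + c) / 2) - sqrt ((b + c) / 2)\<bar> = \<bar>sqrt (a + c) - sqrt (b + c)\<bar> / sqrt 2"
    by (simp add: real_sqrt_divide flip: diff_divide_distrib)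
  also have "\<dots> \<le> \<bar>sqrt (a + c) - sqrt (b + c)\<bar> / 1"
    by (intro divide_left_mono) auto
  finally show ?thesis using abs_sqrt_add_diff_le[OF assms] by simp
qed

definition midpoint_gap :: "(real \<Rightarrow> real) \<Rightarrow> (real \<Rightarrow> real) \<Rightarrow> real" where
  "midpoint_gap t u = (hellinger t (\<lambda>x. (t x + u x) / 2))\<^sup>2 - (hellinger u (\<lambda>x. (t x + u x) / 2))\<^sup>2"

text \<open>The root of the midpoint moves by at most \<open>\<bar>sqrt t - sqrt t'\<bar>\<close>.
  With \<theta> both as Young weight and as bound on the distance, the two squared distances
  contribute errors of at most 9 \<theta> and 3 \<theta>.\<close>

lemma midpoint_gap_perturb:
  assumes t: "t \<in> densities" and t': "t' \<in> densities" and u: "u \<in> densities"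
    and th: "0 < \<theta>" "\<theta> \<le> 1" "hellinger t t' \<le> \<theta>"
  shows "midpoint_gap t' u \<le> midpoint_gap t u + 12 * \<theta>"
proof -
  note p = densitiesD(2)[OF t] densitiesD(2)[OF t'] densitiesD(2)[OF u]
  let ?r = "\<lambda>x. (t x + u x) / 2" and ?r' = "\<lambda>x. (t' x + u x) / 2"
  note r = density_midpoint[OF t u] and r' = density_midpoint[OF t' u]
  have d: "\<bar>sqrt (?r x) - sqrt (?r' x)\<bar> \<le> \<bar>sqrt (t x) - sqrt (t' x)\<bar>" for x
    using p by (intro abs_sqrt_midpoint_diff_le) auto
  have A: "(hellinger t' ?r')\<^sup>2 \<le> (1 + \<theta>) * (hellinger t ?r)\<^sup>2 + (1 + 1 / \<theta>) * 2\<^sup>2 * (hellinger t t')\<^sup>2"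
  proof (rule hellinger_sq_perturb[OF t r t' r' t t' th(1)])
    show "\<bar>sqrt (t' x) - sqrt (?r' x) - (sqrt (t x) - sqrt (?r x))\<bar> \<le> 2 * \<bar>sqrt (t x) - sqrt (t' x)\<bar>" for x
    proof -
      have "\<bar>a' - r' - (a - r)\<bar> \<le> 2 * \<bar>a - a'\<bar>" if "\<bar>r - r'\<bar> \<le> \<bar>a - a'\<bar>" for a a' r r' :: real
        using that abs_triangle_ineq[of "a' - a" "r - r'"] by (simp add: algebra_simps abs_minus_commute)
      then show ?thesis using d[of x] by blast
    qed
  qed
  have B: "(hellinger u ?r)\<^sup>2 \<le> (1 + \<theta>) * (hellinger u ?r')\<^sup>2 + (1 + 1 / \<theta>) * 1\<^sup>2 * (hellinger t t')\<^sup>2"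
  proof (rule hellinger_sq_perturb[OF u r' u r t t' th(1)])
    show "\<bar>sqrt (u x) - sqrt (?r x) - (sqrt (u x) - sqrt (?r' x))\<bar> \<le> 1 * \<bar>sqrt (t x) - sqrt (t' x)\<bar>" for x
      using d[of x] by (simp add: abs_minus_commute)
  qed
  have "\<theta>\<^sup>2 \<le> \<theta>" using th by (simp add: power2_eq_square mult_left_le)
  have "(hellinger t t')\<^sup>2 \<le> \<theta>\<^sup>2"
    using th hellinger_nonneg by (intro power_mono) auto
  then have "(1 + 1 / \<theta>) * (hellinger t t')\<^sup>2 \<le> (1 + 1 / \<theta>) * \<theta>\<^sup>2"
    using th by (intro mult_left_mono) auto
  also have "\<dots> = \<theta>\<^sup>2 + \<theta>"
    using th by (simp add: power2_eq_square field_simps)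
  finally have e: "(1 + 1 / \<theta>) * (hellinger t t')\<^sup>2 \<le> 2 * \<theta>"
    using \<open>\<theta>\<^sup>2 \<le> \<theta>\<close> by linarith
  have "\<theta> * (hellinger t ?r)\<^sup>2 \<le> \<theta>" "\<theta> * (hellinger u ?r')\<^sup>2 \<le> \<theta>"
    using th hellinger_sq_le_1[OF t r] hellinger_sq_le_1[OF u r'] by (auto intro!: mult_left_le)
  moreover have "(1 + 1 / \<theta>) * 2\<^sup>2 * (hellinger t t')\<^sup>2 = 4 * ((1 + 1 / \<theta>) * (hellinger t t')\<^sup>2)"
    by simp
  ultimately show ?thesis
    using A B e unfolding midpoint_gap_def by (simp only: distrib_right) simp
qed

subsection \<open>Mean and second moment of the score\<close>

text \<open>After expanding both sides this is concavity of the square root at \<open>a\<close> and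
  \<open>b\<close>.\<close>

lemma sq_sqrt_diff_midpoint_le:
  fixes a b s :: real
  assumes "0 \<le> a" "0 \<le> b" "0 \<le> s"
  shows "(sqrt s - sqrt ((a + b) / 2))\<^sup>2 \<le> ((sqrt s - sqrt a)\<^sup>2 + (sqrt s - sqrt b)\<^sup>2) / 2"
proof -
  have "(sqrt a + sqrt b) / 2 \<le> sqrt ((a + b) / 2)"
  proof (rule real_le_rsqrt)
    have "0 \<le> (sqrt a - sqrt b)\<^sup>2" by simp
    then show "((sqrt a + sqrt b) / 2)\<^sup>2 \<le> (a + b) / 2"
      using assms by (simp add: power2_sum power2_diff power_divide)
  qed
  then have "sqrt s * ((sqrt a + sqrt b) / 2) \<le> sqrt s * sqrt ((a + b) / 2)"
    using assms by (intro mult_left_mono) auto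
  moreover have "(sqrt s - sqrt ((a + b) / 2))\<^sup>2 = s + (a + b) / 2 - 2 * (sqrt s * sqrt ((a + b) / 2))"
    using assms by (simp add: power2_diff)
  moreover have "(sqrt s - sqrt a)\<^sup>2 + (sqrt s - sqrt b)\<^sup>2
      = 2 * s + (a + b) - 4 * (sqrt s * ((sqrt a + sqrt b) / 2))"
    using assms by (simp add: power2_diff algebra_simps)
  ultimately show ?thesis by argo
qed

text \<open>With \<open>q = (sqrt b - sqrt a) / sqrt r\<close>, expanding
  \<open>q (sqrt s - sqrt r)^2\<close> shows that the left side equals \<open>(b - a) / 4\<close>
  plus half of \<open>(sqrt s - sqrt a)^2 - (sqrt s - sqrt b)^2 + q (sqrt s - sqrt r)^2\<close>. The
  last square is controlled by \<open>q \<le> sqrt 2\<close> and concavity;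
  \<open>(b - a) / 4\<close> integrates to zero.\<close>

lemma score_test_pointwise:
  fixes a b s :: real
  assumes "0 \<le> a" "0 \<le> b" "0 \<le> s"
  defines "r \<equiv> (a + b) / 2"
  shows "((sqrt a - sqrt r)\<^sup>2 - (sqrt b - sqrt r)\<^sup>2) / 4 + score a b * s / sqrt 2
    \<le> (b - a) / 4 + (1 / 2 + sqrt 2 / 4) * (sqrt s - sqrt a)\<^sup>2 - (1 / 2 - sqrt 2 / 4) * (sqrt s - sqrt b)\<^sup>2"
proof -
  define q where "q = (sqrt b - sqrt a) / sqrt r"
  have r: "r \<ge> 0" using assms by simp
  have s2r: "sqrt (a + b) = sqrt 2 * sqrt r"
    by (simp add: r_def real_sqrt_mult[symmetric])
  have sc: "score a b / sqrt 2 = q / 2"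
    by (simp add: score_def s2r q_def)
  have qr: "q * sqrt r = sqrt b - sqrt a"
  proof (cases "r = 0")
    case True
    then have "a = 0" "b = 0" using assms by auto
    then show ?thesis using True by simp
  qed (simp add: q_def)
  have q: "q \<le> sqrt 2"
  proof -
    have "sqrt 2 * (sqrt 2 * (q / 2)) = sqrt 2 * score a b"
      unfolding sc[symmetric] by simp
    then have "q = sqrt 2 * score a b" by (simp flip: mult.assoc)
    also have "\<dots> \<le> sqrt 2 * 1"
      using abs_score_le_1[of a b] assms by (intro mult_left_mono) auto
    finally show ?thesis by simp
  qed
  have e1: "(sqrt a - sqrt r)\<^sup>2 - (sqrt b - sqrt r)\<^sup>2 = a - b + 2 * (q * sqrt r) * sqrt r"
    unfolding qr using assms r by (simp add: power2_diff algebra_simps)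
  have e2: "q * (sqrt s - sqrt r)\<^sup>2 = q * s + q * r - 2 * (q * sqrt r) * sqrt s"
    using assms r by (simp add: power2_diff algebra_simps)
  have e3: "2 * (q * sqrt r) * sqrt s = (sqrt s - sqrt a)\<^sup>2 - (sqrt s - sqrt b)\<^sup>2 + b - a"
    unfolding qr using assms by (simp add: power2_diff algebra_simps)
  have e4: "2 * (q * sqrt r) * sqrt r = 2 * (q * r)" using r by simp
  have "q * (sqrt s - sqrt r)\<^sup>2 \<le> sqrt 2 * (sqrt s - sqrt r)\<^sup>2"
    using q by (intro mult_right_mono) auto
  also have "\<dots> \<le> sqrt 2 * (((sqrt s - sqrt a)\<^sup>2 + (sqrt s - sqrt b)\<^sup>2) / 2)"
    using sq_sqrt_diff_midpoint_le[of a b s] assms by (intro mult_left_mono) (auto simp: r_def)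
  finally have le: "q * s + q * r - ((sqrt s - sqrt a)\<^sup>2 - (sqrt s - sqrt b)\<^sup>2 + b - a)
     \<le> sqrt 2 * (((sqrt s - sqrt a)\<^sup>2 + (sqrt s - sqrt b)\<^sup>2) / 2)"
    using e2 e3 by linarith
  have sc': "score a b * s / sqrt 2 = q * s / 2" using sc by (simp add: field_simps)
  show ?thesis using le unfolding e1 e4 sc' by (simp add: algebra_simps add_divide_distrib diff_divide_distrib)
qed

text \<open>Replacing \<open>s\<close> by the midpoint \<open>r\<close> makes the denominator of the
  score cancel, because \<open>(score a b)^2 (a + b) = (sqrt b - sqrt a)^2\<close>; the replacement
  costs a multiple of \<open>(sqrt s - sqrt r)^2\<close>.\<close>

lemma score_sq_pointwise:
  fixes a b s :: real
  assumes "0 \<le> a" "0 \<le> b" "0 \<le> s"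
  shows "(score a b)\<^sup>2 * s \<le> 3 * ((sqrt s - sqrt a)\<^sup>2 + (sqrt s - sqrt b)\<^sup>2)"
proof -
  define r where "r = (a + b) / 2"
  have r: "r \<ge> 0" using assms by (simp add: r_def)
  have "s \<le> 2 * (sqrt s - sqrt r)\<^sup>2 + 2 * r"
  proof -
    have "0 \<le> (sqrt s - 2 * sqrt r)\<^sup>2" by simp
    then show ?thesis using assms r by (simp add: power2_diff power_mult_distrib algebra_simps)
  qed
  then have "(score a b)\<^sup>2 * s \<le> (score a b)\<^sup>2 * (2 * (sqrt s - sqrt r)\<^sup>2 + 2 * r)"
    by (intro mult_left_mono) auto
  also have "\<dots> = (score a b)\<^sup>2 * (2 * (sqrt s - sqrt r)\<^sup>2) + (score a b)\<^sup>2 * (a + b)"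
    by (simp add: r_def algebra_simps)
  also have "(score a b)\<^sup>2 * (2 * (sqrt s - sqrt r)\<^sup>2) \<le> 2 * (sqrt s - sqrt r)\<^sup>2"
    using abs_score_le_1[of a b] assms by (intro mult_left_le_one_le) (auto simp: abs_square_le_1)
  also have "(score a b)\<^sup>2 * (a + b) = (sqrt b - sqrt a)\<^sup>2"
  proof (cases "a + b = 0")
    case True
    then show ?thesis using assms by (auto simp: score_def add_nonneg_eq_0_iff)
  qed (use assms in \<open>simp add: score_def power_divide\<close>)
  also have "(sqrt b - sqrt a)\<^sup>2 \<le> 2 * ((sqrt s - sqrt a)\<^sup>2 + (sqrt s - sqrt b)\<^sup>2)"
  proof -
    have "(y - x)\<^sup>2 \<le> 2 * ((z - x)\<^sup>2 + (z - y)\<^sup>2)" for x y z :: real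
      using zero_le_power2[of "(z - x) + (z - y)"] by (simp add: power2_eq_square algebra_simps)
    then show ?thesis .
  qed
  also have "(sqrt s - sqrt r)\<^sup>2 \<le> ((sqrt s - sqrt a)\<^sup>2 + (sqrt s - sqrt b)\<^sup>2) / 2"
    using sq_sqrt_diff_midpoint_le[of a b s] assms by (simp add: r_def)
  finally show ?thesis by (simp add: add_divide_distrib)
qed

lemma integrable_bounded_mult_density:
  assumes "s \<in> densities" "f \<in> borel_measurable borel" "\<And>x. \<bar>f x\<bar> \<le> 1"
  shows "integrable lborel (\<lambda>x. f x * s x)"
proof (rule Bochner_Integration.integrable_bound[where f = s])
  note s = densitiesD[OF assms(1)]
  note [measurable] = s(1) assms(2)
  show "integrable lborel s" by fact
  show "(\<lambda>x. f x * s x) \<in> borel_measurable lborel" by measurable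
  show "AE x in lborel. norm (f x * s x) \<le> norm (s x)"
    using assms(3) s(2) by (intro AE_I2) (auto simp: abs_mult intro!: mult_left_le_one_le)
qed

text \<open>The negative multiple of the squared distance from \<open>s\<close> to \<open>b\<close>
  is the gain of the test; it later absorbs the second moment of the score.\<close>

lemma score_test_expectation:
  assumes s: "s \<in> densities" and a: "a \<in> densities" and b: "b \<in> densities"
  shows "midpoint_gap a b / 2 + (LINT x|lborel. score (a x) (b x) * s x) / sqrt 2
     \<le> (1 + sqrt 2 / 2) * (hellinger s a)\<^sup>2 - (1 - sqrt 2 / 2) * (hellinger s b)\<^sup>2"
proof -
  note S = densitiesD[OF s] and A = densitiesD[OF a] and B = densitiesD[OF b]
  note [measurable] = S(1) A(1) B(1)
  let ?r = "\<lambda>x. (a x + b x) / 2"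
  have r: "?r \<in> densities" using a b by (rule density_midpoint)
  have sc: "integrable lborel (\<lambda>x. score (a x) (b x) * s x)"
    using A B abs_score_le_1 by (intro integrable_bounded_mult_density s) auto
  note I = integrable_sqrt_diff_sq
  have "(LINT x|lborel. ((sqrt (a x) - sqrt (?r x))\<^sup>2 - (sqrt (b x) - sqrt (?r x))\<^sup>2) / 4
        + score (a x) (b x) * s x / sqrt 2)
      \<le> (LINT x|lborel. (b x - a x) / 4 + (1 / 2 + sqrt 2 / 4) * (sqrt (s x) - sqrt (a x))\<^sup>2
        - (1 / 2 - sqrt 2 / 4) * (sqrt (s x) - sqrt (b x))\<^sup>2)"
    using I[OF a r] I[OF b r] I[OF s a] I[OF s b] sc S A B
    by (intro integral_mono score_test_pointwise) auto
  also have "\<dots> = (1 / 2 + sqrt 2 / 4) * (LINT x|lborel. (sqrt (s x) - sqrt (a x))\<^sup>2)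
        - (1 / 2 - sqrt 2 / 4) * (LINT x|lborel. (sqrt (s x) - sqrt (b x))\<^sup>2)"
    using I[OF s a] I[OF s b] A B by simp
  also have "(LINT x|lborel. ((sqrt (a x) - sqrt (?r x))\<^sup>2 - (sqrt (b x) - sqrt (?r x))\<^sup>2) / 4
        + score (a x) (b x) * s x / sqrt 2) =
      ((LINT x|lborel. (sqrt (a x) - sqrt (?r x))\<^sup>2) - (LINT x|lborel. (sqrt (b x) - sqrt (?r x))\<^sup>2)) / 4
        + (LINT x|lborel. score (a x) (b x) * s x) / sqrt 2"
    using I[OF a r] I[OF b r] sc by simp
  finally show ?thesis
    unfolding midpoint_gap_def hellinger_sq by (simp add: field_simps)
qed

lemma score_sq_expectation:
  assumes s: "s \<in> densities" and a: "a \<in> densities" and b: "b \<in> densities"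
  shows "(LINT x|lborel. (score (a x) (b x))\<^sup>2 * s x) \<le> 6 * ((hellinger s a)\<^sup>2 + (hellinger s b)\<^sup>2)"
proof -
  note S = densitiesD[OF s] and A = densitiesD[OF a] and B = densitiesD[OF b]
  note [measurable] = S(1) A(1) B(1)
  note I = integrable_sqrt_diff_sq
  have sc: "integrable lborel (\<lambda>x. (score (a x) (b x))\<^sup>2 * s x)"
    using A B abs_score_le_1 by (intro integrable_bounded_mult_density s) (auto simp: abs_square_le_1)
  have "(LINT x|lborel. (score (a x) (b x))\<^sup>2 * s x) \<le>
     (LINT x|lborel. 3 * ((sqrt (s x) - sqrt (a x))\<^sup>2 + (sqrt (s x) - sqrt (b x))\<^sup>2))"
    using I[OF s a] I[OF s b] sc S A B by (intro integral_mono score_sq_pointwise) auto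
  also have "\<dots> = 6 * ((hellinger s a)\<^sup>2 + (hellinger s b)\<^sup>2)"
    using I[OF s a] I[OF s b] by (simp add: hellinger_sq)
  finally show ?thesis .
qed


subsection \<open>Relative deviations\<close>

lemma exp_minus_le:
  fixes x :: real
  assumes "0 \<le> x"
  shows "exp (- x) \<le> 1 - x + x\<^sup>2"
proof -
  \<comment> \<open>The product is \<open>1 + x^3\<close>.\<close>
  have "1 \<le> (1 + x) * (1 - x + x\<^sup>2)"
    using assms by (simp add: algebra_simps power2_eq_square)
  also have "\<dots> \<le> exp x * (1 - x + x\<^sup>2)"
  proof (rule mult_right_mono)
    have "0 \<le> (1 - x / 2)\<^sup>2 + 3 * x\<^sup>2 / 4" by simp
    also have "\<dots> = 1 - x + x\<^sup>2" by (simp add: power2_eq_square field_simps)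
    finally show "0 \<le> 1 - x + x\<^sup>2" .
  qed simp
  finally show ?thesis by (simp add: exp_minus field_simps)
qed

text \<open>Markov's inequality for the exponential of the sum: the moment generating function
  factorizes over the sample and \<open>1 + u \<le> exp u\<close> bounds each factor. The parameter
  \<theta> may have either sign, which covers both tails.\<close>

lemma (in prob_space) chernoff_indicator:
  assumes I: "finite I" and A: "A \<in> events"
  defines "Q \<equiv> Pi\<^sub>M I (\<lambda>_. M)"
  shows "measure Q {X \<in> space Q. z \<le> \<theta> * (\<Sum>i\<in>I. indicator A (X i)) - real (card I) * ((exp \<theta> - 1) * prob A)}
     \<le> exp (- z)"
proof -
  interpret Q: product_prob_space "\<lambda>_. M" I by standard
  have [measurable]: "A \<in> events" by fact
  have QI: "prob_space Q" unfolding Q_def by (rule prob_space_PiM) (rule prob_space_axioms)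
  interpret QQ: prob_space Q by (rule QI)
  define c where "c = real (card I) * ((exp \<theta> - 1) * prob A)"
  have ind: "integrable M (indicat_real A)"
    by (intro integrable_real_indicator) (auto simp: less_top[symmetric])
  have "(\<integral>\<^sup>+x. ennreal (exp (\<theta> * indicator A x)) \<partial>M) = (\<integral>\<^sup>+x. ennreal (1 + (exp \<theta> - 1) * indicator A x) \<partial>M)"
    by (intro nn_integral_cong) (auto simp: indicator_def)
  also have "\<dots> = ennreal (expectation (\<lambda>x. 1 + (exp \<theta> - 1) * indicator A x))"
    by (intro nn_integral_eq_integral Bochner_Integration.integrable_add integrable_mult_right
        ind) (auto simp: indicator_def)
  also have "expectation (\<lambda>x. 1 + (exp \<theta> - 1) * indicator A x) = 1 + (exp \<theta> - 1) * prob A"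
    using ind by (subst Bochner_Integration.integral_add) (auto simp: prob_space)
  also have "ennreal \<dots> \<le> ennreal (exp ((exp \<theta> - 1) * prob A))"
    by (intro ennreal_leI exp_ge_add_one_self)
  finally have one: "(\<integral>\<^sup>+x. ennreal (exp (\<theta> * indicator A x)) \<partial>M) \<le> ennreal (exp ((exp \<theta> - 1) * prob A))" .
  have "(\<integral>\<^sup>+X. ennreal (exp (\<theta> * (\<Sum>i\<in>I. indicator A (X i)))) \<partial>Q)
      = (\<integral>\<^sup>+X. (\<Prod>i\<in>I. ennreal (exp (\<theta> * indicator A (X i)))) \<partial>Q)"
    by (intro nn_integral_cong) (simp only: sum_distrib_left exp_sum[OF I] prod_ennreal exp_ge_zero)
  also have "\<dots> = (\<Prod>i\<in>I. (\<integral>\<^sup>+x. ennreal (exp (\<theta> * indicator A x)) \<partial>M))"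
    unfolding Q_def by (rule Q.product_nn_integral_prod[OF I]) auto
  also have "\<dots> \<le> (\<Prod>i\<in>I. ennreal (exp ((exp \<theta> - 1) * prob A)))"
    using one by (intro prod_mono_ennreal) auto
  also have "\<dots> = ennreal (exp c)"
    by (simp add: ennreal_power c_def flip: exp_of_nat_mult)
  finally have mgf: "(\<integral>\<^sup>+X. ennreal (exp (\<theta> * (\<Sum>i\<in>I. indicator A (X i)))) \<partial>Q) \<le> ennreal (exp c)" .
  have meas[measurable]: "(\<lambda>X. ennreal (exp (\<theta> * (\<Sum>i\<in>I. indicator A (X i))))) \<in> borel_measurable Q"
    unfolding Q_def by measurable
  have "emeasure Q {X \<in> space Q. 1 \<le> ennreal (exp (- (z + c))) * ennreal (exp (\<theta> * (\<Sum>i\<in>I. indicator A (X i))))}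
     \<le> ennreal (exp (- (z + c))) * (\<integral>\<^sup>+X. ennreal (exp (\<theta> * (\<Sum>i\<in>I. indicator A (X i)))) * indicator (space Q) X \<partial>Q)"
    by (rule nn_integral_Markov_inequality) auto
  also have "(\<integral>\<^sup>+X. ennreal (exp (\<theta> * (\<Sum>i\<in>I. indicator A (X i)))) * indicator (space Q) X \<partial>Q)
      = (\<integral>\<^sup>+X. ennreal (exp (\<theta> * (\<Sum>i\<in>I. indicator A (X i)))) \<partial>Q)"
    by (intro nn_integral_cong) simp
  also have "ennreal (exp (- (z + c))) * \<dots> \<le> ennreal (exp (- (z + c))) * ennreal (exp c)"
    by (intro mult_left_mono mgf) auto
  also have "\<dots> = ennreal (exp (- z))"
    by (simp add: ennreal_mult[symmetric] exp_add[symmetric])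
  also have "{X \<in> space Q. 1 \<le> ennreal (exp (- (z + c))) * ennreal (exp (\<theta> * (\<Sum>i\<in>I. indicator A (X i))))}
     = {X \<in> space Q. z \<le> \<theta> * (\<Sum>i\<in>I. indicator A (X i)) - c}"
    by (auto simp: ennreal_mult[symmetric] exp_add[symmetric] ennreal_1[symmetric] simp del: ennreal_1)
  finally show ?thesis
    unfolding c_def[symmetric] by (simp add: QQ.emeasure_eq_measure)
qed

lemma amgm_weighted:
  fixes p y l :: real
  assumes "0 \<le> p" "0 \<le> y" "0 < l"
  shows "2 * sqrt (p * y) \<le> l * p + y / l"
proof -
  have "0 \<le> (sqrt (l * p) - sqrt (y / l))\<^sup>2" by simp
  also have "\<dots> = l * p + y / l - 2 * (sqrt (l * p) * sqrt (y / l))"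
    using assms by (simp add: power2_diff)
  also have "sqrt (l * p) * sqrt (y / l) = sqrt (p * y)"
    using assms by (simp add: real_sqrt_mult[symmetric])
  finally show ?thesis by simp
qed

text \<open>One Chernoff parameter, tuned to the mass of \<open>A\<close>, makes the linear bounds hold for all
  \<open>l\<close> simultaneously.\<close>

lemma (in prob_space) relative_deviation_event:
  assumes I: "finite I" and A: "A \<in> events" and y: "0 < y"
  defines "Q \<equiv> Pi\<^sub>M I (\<lambda>_. M)" and "n \<equiv> real (card I)"
  shows "\<exists>B\<in>sets Q. measure Q B \<le> 2 * exp (- (n * y)) \<and>
    (\<forall>X\<in>space Q - B. \<forall>l. 0 < l \<longrightarrow> l \<le> 1 \<longrightarrow>
       (\<Sum>i\<in>I. indicator A (X i)) \<le> n * ((1 + l) * prob A + 2 * y / l) \<and>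
       n * ((1 - l) * prob A - 2 * y / l) \<le> (\<Sum>i\<in>I. indicator A (X i)))"
proof -
  define p where "p = prob A"
  \<comment> \<open>This is the minimizer of \<open>\<theta> p + y / \<theta>\<close> over (0,1]. It
    depends on \<open>p\<close> and \<open>y\<close> only, so one exceptional event serves every
    \<open>l\<close>.\<close>
  define \<theta> where "\<theta> = (if y \<le> p then sqrt (y / p) else 1)"
  have p: "0 \<le> p" by (simp add: p_def)
  have th: "0 < \<theta>" "\<theta> \<le> 1" using y by (auto simp: \<theta>_def)
  have opt: "\<theta> * p + y / \<theta> \<le> l * p + 2 * y / l" if l: "0 < l" "l \<le> 1" for l
  proof (cases "y \<le> p")
    case True
    then have "0 < p" using y by simp
    then have "\<theta> * p = sqrt (p * y)" "y / \<theta> = sqrt (p * y)"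
      using True y by (simp_all add: \<theta>_def real_sqrt_divide real_sqrt_mult field_simps)
    then have "\<theta> * p + y / \<theta> \<le> l * p + y / l"
      using amgm_weighted[of p y l] y p l by simp
    also have "y / l \<le> 2 * y / l" using y l by (simp add: divide_right_mono)
    finally show ?thesis by simp
  next
    case False
    then have "\<theta> * p + y / \<theta> \<le> 2 * y" by (simp add: \<theta>_def)
    also have "\<dots> \<le> 2 * y / l" using y l by (simp add: field_simps)
    also have "\<dots> \<le> l * p + 2 * y / l" using p l by simp
    finally show ?thesis .
  qed
  define U where "U = {X \<in> space Q. n * y \<le> \<theta> * (\<Sum>i\<in>I. indicator A (X i)) - n * ((exp \<theta> - 1) * p)}"
  define V where "V = {X \<in> space Q. n * y \<le> (- \<theta>) * (\<Sum>i\<in>I. indicator A (X i)) - n * ((exp (- \<theta>) - 1) * p)}"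
  have [measurable]: "A \<in> events" by fact
  have sets: "U \<in> sets Q" "V \<in> sets Q" unfolding U_def V_def Q_def by measurable
  interpret QQ: prob_space Q unfolding Q_def by (rule prob_space_PiM) (rule prob_space_axioms)
  have "measure Q (U \<union> V) \<le> measure Q U + measure Q V"
    using sets by (rule measure_Un_le)
  also have "\<dots> \<le> exp (- (n * y)) + exp (- (n * y))"
    unfolding U_def V_def Q_def n_def p_def by (intro add_mono chernoff_indicator I A)
  finally have m: "measure Q (U \<union> V) \<le> 2 * exp (- (n * y))" by simp
  show ?thesis
  proof (intro bexI[of _ "U \<union> V"] conjI m ballI allI impI)
    fix X l assume X: "X \<in> space Q - (U \<union> V)" and l: "0 < l" "l \<le> (1::real)"
    define S :: real where "S = (\<Sum>i\<in>I. indicator A (X i))"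
    have n: "0 \<le> n" by (simp add: n_def)
    have u: "\<theta> * S < n * y + n * ((exp \<theta> - 1) * p)" and v: "(- \<theta>) * S < n * y + n * ((exp (- \<theta>) - 1) * p)"
      using X by (auto simp: U_def V_def S_def)
    \<comment> \<open>Second-order bounds on the exponential, valid as \<theta> \<le> 1; dividing by
      \<theta> leaves the error \<open>\<theta> p + y / \<theta>\<close>, which \<open>opt\<close>
      compares with every \<open>l\<close>.\<close>
    have "n * ((exp \<theta> - 1) * p) \<le> n * ((\<theta> + \<theta>\<^sup>2) * p)"
      using exp_bound[of \<theta>] th p n by (intro mult_left_mono mult_right_mono) auto
    then have "\<theta> * S \<le> \<theta> * (n * (p + (\<theta> * p + y / \<theta>)))"
      using u th by (simp add: algebra_simps power2_eq_square)
    then have "S \<le> n * (p + (\<theta> * p + y / \<theta>))" using th by simp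
    also have "\<dots> \<le> n * (p + (l * p + 2 * y / l))"
      using opt[OF l] n by (intro mult_left_mono) auto
    finally show "(\<Sum>i\<in>I. indicator A (X i)) \<le> n * ((1 + l) * prob A + 2 * y / l)"
      by (simp add: S_def p_def algebra_simps)
    have "n * ((exp (- \<theta>) - 1) * p) \<le> n * ((- \<theta> + \<theta>\<^sup>2) * p)"
      using exp_minus_le[of \<theta>] th p n by (intro mult_left_mono mult_right_mono) auto
    then have "\<theta> * (n * (p - (\<theta> * p + y / \<theta>))) \<le> \<theta> * S"
      using v th by (simp add: algebra_simps power2_eq_square)
    then have "n * (p - (\<theta> * p + y / \<theta>)) \<le> S" using th by simp
    moreover have "n * (p - (l * p + 2 * y / l)) \<le> n * (p - (\<theta> * p + y / \<theta>))"
      using opt[OF l] n by (intro mult_left_mono) auto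
    ultimately show "n * ((1 - l) * prob A - 2 * y / l) \<le> (\<Sum>i\<in>I. indicator A (X i))"
      by (simp add: S_def p_def algebra_simps)
  qed (use sets in auto)
qed

subsection \<open>Unions of few runs\<close>

text \<open>The switching points of the indicator of \<open>J\<close>, read from left to right with
  a virtual non-member before 0. Each maximal run produces one switch on and one switch off, so few
  runs means a small boundary.\<close>

definition boundary :: "nat set \<Rightarrow> nat set" where
  "boundary J = {k. (k \<in> J) \<noteq> (0 < k \<and> k - 1 \<in> J)}"

definition run_sets :: "nat \<Rightarrow> nat \<Rightarrow> nat set set" where
  "run_sets N m = {J. J \<subseteq> {..N} \<and> card (boundary J) \<le> m}"

text \<open>A run reaching \<open>N\<close> switches off at \<open>Suc N\<close>, hence the shifted
  range.\<close>

lemma boundary_subset: "J \<subseteq> {..N} \<Longrightarrow> boundary J \<subseteq> {..Suc N}"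
  by (force simp: boundary_def)

lemma inj_boundary: "inj boundary"
proof (rule injI)
  fix J J' assume eq: "boundary J = boundary J'"
  have "k \<in> J \<longleftrightarrow> k \<in> J'" for k
  proof (induction k)
    case 0
    have "0 \<in> boundary J \<longleftrightarrow> 0 \<in> boundary J'" by (simp add: eq)
    then show ?case by (simp add: boundary_def)
  next
    case (Suc k)
    have "Suc k \<in> boundary J \<longleftrightarrow> Suc k \<in> boundary J'" by (simp add: eq)
    then show ?case using Suc by (auto simp: boundary_def)
  qed
  then show "J = J'" by blast
qed

lemma boundary_UN: "boundary (\<Union>i\<in>I. J i) \<subseteq> (\<Union>i\<in>I. boundary (J i))"
  by (auto simp: boundary_def)

lemma finite_run_sets: "finite (run_sets N m)"
  by (rule finite_subset[of _ "Pow {..N}"]) (auto simp: run_sets_def)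

lemma sum_Pow_power_card:
  fixes x :: "'b :: comm_semiring_1"
  assumes "finite U"
  shows "(\<Sum>B\<in>Pow U. x ^ card B) = (1 + x) ^ card U"
  using assms
proof (induction U rule: finite_induct)
  case (insert a U)
  have inj: "inj_on (insert a) (Pow U)"
    using insert.hyps(2) by (force intro!: inj_onI)
  have "(\<Sum>B\<in>Pow (insert a U). x ^ card B) = (\<Sum>B\<in>Pow U. x ^ card B) + (\<Sum>B\<in>insert a ` Pow U. x ^ card B)"
    unfolding Pow_insert using insert.hyps by (intro sum.union_disjoint) auto
  also have "(\<Sum>B\<in>insert a ` Pow U. x ^ card B) = (\<Sum>B\<in>Pow U. x * x ^ card B)"
    unfolding sum.reindex[OF inj] using insert.hyps
    by (intro sum.cong refl) (auto simp: card_insert_if finite_subset subset_iff)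
  finally show ?case
    using insert by (simp add: sum_distrib_left[symmetric] algebra_simps)
qed simp

text \<open>A set is determined by its boundary; the weights \<open>x ^ (card B - m) \<ge> 1\<close> turn the number of
  boundaries of size at most \<open>m\<close> into a binomial sum.\<close>

lemma card_run_sets_le:
  fixes x :: real
  assumes "0 < x" "x \<le> 1"
  shows "real (card (run_sets N m)) \<le> (1 / x) ^ m * (1 + x) ^ (N + 2)"
proof -
  let ?B = "{B \<in> Pow {..Suc N}. card B \<le> m}"
  have "card (run_sets N m) = card (boundary ` run_sets N m)"
    by (metis card_image inj_boundary inj_on_subset subset_UNIV)
  also have "\<dots> \<le> card ?B"
    by (intro card_mono) (auto simp: run_sets_def dest: boundary_subset)
  also have "real (card ?B) = (\<Sum>B\<in>?B. 1)" by simp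
  also have "\<dots> \<le> (\<Sum>B\<in>?B. (1 / x) ^ m * x ^ card B)"
  proof (rule sum_mono)
    fix B assume "B \<in> ?B"
    then have "x ^ m \<le> x ^ card B" using assms by (intro power_decreasing) auto
    then show "1 \<le> (1 / x) ^ m * x ^ card B" using assms by (simp add: field_simps)
  qed
  also have "\<dots> \<le> (\<Sum>B\<in>Pow {..Suc N}. (1 / x) ^ m * x ^ card B)"
    using assms by (intro sum_mono2) auto
  also have "\<dots> = (1 / x) ^ m * (1 + x) ^ (N + 2)"
    by (simp add: sum_distrib_left[symmetric] sum_Pow_power_card)
  finally show ?thesis by simp
qed

text \<open>Here \<kappa> is a monotone cell index. An interval \<open>S\<close> whose cells range
  from \<open>a S\<close> to \<open>b S\<close> contains every cell strictly between, by convexity,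
  and is covered by the cells \<open>a S\<close> to \<open>b S\<close>. Inner and outer
  approximation differ only in the two end cells of each interval.\<close>

lemma interval_family_sandwich:
  fixes \<kappa> :: "real \<Rightarrow> nat" and C :: "real set set"
  assumes "mono \<kappa>" "\<And>x. \<kappa> x \<le> N" "finite C" "card C \<le> K" "\<And>S. S \<in> C \<Longrightarrow> is_interval S"
  shows "\<exists>J\<in>run_sets N (2 * K). \<exists>J'\<in>run_sets N (2 * K). \<exists>E. finite E \<and> card E \<le> 2 * K \<and> J' \<subseteq> J \<union> E \<and>
     \<kappa> -` J \<subseteq> \<Union>C \<and> \<Union>C \<subseteq> \<kappa> -` J'"
proof -
  \<comment> \<open>Empty intervals are dropped so that \<open>Min\<close> and \<open>Max\<close> of
    the cell indices exist.\<close>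
  define C' where "C' = {S \<in> C. S \<noteq> {}}"
  have C': "finite C'" "card C' \<le> K" "\<Union>C = \<Union>C'"
    using assms(3,4) card_mono[of C C'] by (auto simp: C'_def)
  define a b where "a S = Min (\<kappa> ` S)" and "b S = Max (\<kappa> ` S)" for S
  have fin: "finite (\<kappa> ` S)" for S
    using assms(2) by (auto intro: finite_subset[of _ "{..N}"])
  have ab: "\<exists>x\<in>S. \<kappa> x = a S" "\<exists>x\<in>S. \<kappa> x = b S" if "S \<in> C'" for S
    using Min_in[OF fin, of S] Max_in[OF fin, of S] that by (auto simp: C'_def a_def b_def)
  have ab_le: "a S \<le> \<kappa> x" "\<kappa> x \<le> b S" if "x \<in> S" for S x
    using that fin by (auto simp: a_def b_def)
  define J J' E where "J = (\<Union>S\<in>C'. {a S<..<b S})" and "J' = (\<Union>S\<in>C'. {a S..b S})"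
    and "E = (\<Union>S\<in>C'. {a S, b S})"
  have bN: "b S \<le> N" if "S \<in> C'" for S using ab(2)[OF that] assms(2) by metis
  \<comment> \<open>Serves three times: for the switching points of \<open>J\<close>, for those of
    \<open>J'\<close>, and for the end cells \<open>E\<close>.\<close>
  have card2: "card (\<Union>S\<in>C'. {f S, g S}) \<le> 2 * K" for f g :: "real set \<Rightarrow> nat"
  proof -
    have "card (\<Union>S\<in>C'. {f S, g S}) \<le> (\<Sum>S\<in>C'. card {f S, g S})"
      using C'(1) by (rule card_UN_le)
    also have "\<dots> \<le> (\<Sum>S\<in>C'. 2)" by (intro sum_mono) (simp add: card_insert_if)
    finally show ?thesis using C'(2) by simp
  qed
  have sub: "boundary J \<subseteq> (\<Union>S\<in>C'. {Suc (a S), b S})" "boundary J' \<subseteq> (\<Union>S\<in>C'. {a S, Suc (b S)})"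
    unfolding J_def J'_def using boundary_UN by (fastforce simp: boundary_def)+
  have "card (boundary J) \<le> 2 * K" "card (boundary J') \<le> 2 * K"
    using C'(1) by (auto intro!: order_trans[OF card_mono[OF _ sub(1)] card2] order_trans[OF card_mono[OF _ sub(2)] card2])
  moreover have "J \<subseteq> {..N}" "J' \<subseteq> {..N}" using bN by (fastforce simp: J_def J'_def)+
  ultimately have runs: "J \<in> run_sets N (2 * K)" "J' \<in> run_sets N (2 * K)" by (auto simp: run_sets_def)
  have "J' \<subseteq> J \<union> E" by (force simp: J_def J'_def E_def)
  moreover have "finite E" "card E \<le> 2 * K" using C'(1) card2 by (auto simp: E_def)
  moreover have "\<Union>C \<subseteq> \<kappa> -` J'" using ab_le unfolding C'(3) J'_def by fastforce
  moreover have "\<kappa> -` J \<subseteq> \<Union>C"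
  proof
    fix x assume "x \<in> \<kappa> -` J"
    then obtain S where S: "S \<in> C'" "a S < \<kappa> x" "\<kappa> x < b S" by (auto simp: J_def)
    obtain p q where pq: "p \<in> S" "\<kappa> p = a S" "q \<in> S" "\<kappa> q = b S" using ab[OF S(1)] by blast
    \<comment> \<open>Strict inequality of the indices places \<open>x\<close> between a point of
      the first cell of \<open>S\<close> and a point of its last cell.\<close>
    have "p \<le> x" "x \<le> q"
      using S pq monoD[OF assms(1)] by (metis linorder_not_le nle_le)+
    then have "x \<in> S"
      using assms(5)[of S] S(1) pq unfolding is_interval_1 C'_def by blast
    then show "x \<in> \<Union>C" using S(1) by (auto simp: C'_def)
  qed
  ultimately show ?thesis using runs by blast
qed

subsection \<open>Quantile cells\<close>

text \<open>A continuous cdf pushes the law to the uniform one. Only two halves of this are used: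
  the mass of \<open>{x. cdf M x < \<beta>}\<close> is at most \<beta>, and that of
  \<open>{x. cdf M x < \<alpha>}\<close> is at least \<alpha>.\<close>

lemma (in real_distribution) cdf_slab_le:
  assumes cont: "\<And>x. isCont (cdf M) x" and "0 \<le> \<alpha>" "\<alpha> \<le> \<beta>"
  shows "prob {x. \<alpha> \<le> cdf M x \<and> cdf M x < \<beta>} \<le> \<beta> - \<alpha>"
proof (cases "\<alpha> \<le> 1")
  case False
  then have "\<not> \<alpha> \<le> cdf M x" for x
    using cdf_bounded_prob[of x] by linarith
  then show ?thesis using assms by simp
next
  case True
  have mono: "mono (cdf M)" by (rule monoI) (rule cdf_nondecreasing)
  have [measurable]: "cdf M \<in> borel_measurable borel" by (rule borel_measurable_mono[OF mono])
  have "prob {x. cdf M x < \<beta>} \<le> \<beta>"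
  proof (cases "\<exists>z. \<beta> \<le> cdf M z")
    \<comment> \<open>If the cdf never reaches \<beta>, its limit 1 at infinity forces 1 \<le>
      \<beta>. Otherwise the set lies left of its supremum, where continuity keeps the cdf at most
      \<beta>.\<close>
    case False
    then have "cdf M x \<le> \<beta>" for x by (meson linear)
    then have "1 \<le> \<beta>" by (intro tendsto_upperbound[OF cdf_lim_at_top_prob]) auto
    then show ?thesis by (intro order_trans[OF prob_le_1])
  next
    case True
    then obtain z where z: "\<beta> \<le> cdf M z" by blast
    show ?thesis
    proof (cases "{x. cdf M x < \<beta>} = {}")
      case False
      let ?D = "{x. cdf M x < \<beta>}"
      have bdd: "bdd_above ?D"
        using z by (intro bdd_aboveI[of _ z]) (metis cdf_nondecreasing leD linear mem_Collect_eq order_trans)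
      have "?D \<subseteq> {..Sup ?D}" using cSup_upper[OF _ bdd] by auto
      then have "prob ?D \<le> prob {..Sup ?D}" by (intro finite_measure_mono) auto
      also have "\<dots> = cdf M (Sup ?D)" by (simp add: cdf_def)
      also have "\<dots> \<le> \<beta>"
      proof -
        have "Sup ?D \<in> closure ?D" using False bdd by (intro closure_contains_Sup)
        also have "closure ?D \<subseteq> {x. cdf M x \<le> \<beta>}"
          using cont by (intro closure_minimal closed_Collect_le)
            (auto simp: continuous_on_eq_continuous_at)
        finally show ?thesis by simp
      qed
      finally show ?thesis .
    qed (use assms in simp)
  qed
  moreover have "\<alpha> \<le> prob {x. cdf M x < \<alpha>}"
  proof (rule dense_le)
    fix \<alpha>' assume lt: "\<alpha>' < \<alpha>"
    show "\<alpha>' \<le> prob {x. cdf M x < \<alpha>}"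
    proof (cases "\<alpha>' \<le> 0")
      case False
      \<comment> \<open>The limits at both ends and the intermediate value theorem give a point
        whose cdf is exactly \<alpha>'; the half-line up to it lies in the set.\<close>
      have "eventually (\<lambda>x. cdf M x < \<alpha>') at_bot"
        using False by (intro order_tendstoD(2)[OF cdf_lim_at_bot]) auto
      then obtain p where p: "cdf M p < \<alpha>'" by (auto simp: eventually_at_bot_linorder)
      have "eventually (\<lambda>x. \<alpha>' < cdf M x) at_top"
        using lt True by (intro order_tendstoD(1)[OF cdf_lim_at_top_prob]) auto
      then obtain q where q: "\<alpha>' < cdf M q" by (auto simp: eventually_at_top_linorder)
      have "p \<le> q" using p q cdf_nondecreasing[of q p] by linarith
      then obtain x where x: "cdf M x = \<alpha>'"
        using IVT[of "cdf M" p \<alpha>' q] p q cont by auto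
      have "\<alpha>' = prob {..x}" using x by (simp add: cdf_def)
      also have "\<dots> \<le> prob {x. cdf M x < \<alpha>}"
        using x lt cdf_nondecreasing[of _ x] by (intro finite_measure_mono) (auto intro: le_less_trans)
      finally show ?thesis .
    qed (auto intro: order_trans)
  qed
  moreover have "prob {x. cdf M x < \<beta>} = prob {x. cdf M x < \<alpha>} + prob {x. \<alpha> \<le> cdf M x \<and> cdf M x < \<beta>}"
  proof -
    have "{x. cdf M x < \<beta>} = {x. cdf M x < \<alpha>} \<union> {x. \<alpha> \<le> cdf M x \<and> cdf M x < \<beta>}"
      using assms by auto
    then show ?thesis by (simp only:) (rule finite_measure_Union, auto)
  qed
  ultimately show ?thesis by linarith
qed

text \<open>Cell \<open>k\<close> lies between the quantiles of order \<open>k / n\<close> and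
  \<open>(k + 1) / n\<close>. The extra index \<open>n\<close> is taken where the cdf equals
  1.\<close>

definition (in real_distribution) quantile_cell :: "nat \<Rightarrow> real \<Rightarrow> nat" where
  "quantile_cell n x = nat \<lfloor>real n * cdf M x\<rfloor>"

context real_distribution
begin

lemma mono_quantile_cell: "mono (quantile_cell n)"
  unfolding quantile_cell_def
  by (intro monoI nat_mono floor_mono mult_left_mono cdf_nondecreasing) auto

lemma quantile_cell_le: "quantile_cell n x \<le> n"
proof -
  have "real n * cdf M x \<le> real n * 1"
    by (intro mult_left_mono cdf_bounded_prob) auto
  then have "\<lfloor>real n * cdf M x\<rfloor> \<le> int n" by (simp add: floor_le_iff)
  then show ?thesis by (simp add: quantile_cell_def)
qed

lemma measurable_quantile_cell[measurable]: "quantile_cell n \<in> measurable borel (count_space UNIV)"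
proof -
  have [measurable]: "cdf M \<in> borel_measurable borel"
    by (rule borel_measurable_mono) (auto intro: monoI cdf_nondecreasing)
  show ?thesis unfolding quantile_cell_def by measurable
qed

lemma prob_quantile_cell_le:
  assumes cont: "\<And>x. isCont (cdf M) x" and n: "0 < n"
  shows "prob (quantile_cell n -` {k}) \<le> 1 / real n"
proof -
  have "quantile_cell n -` {k} = {x. real k / n \<le> cdf M x \<and> cdf M x < (real k + 1) / n}"
  proof -
    have "quantile_cell n x = k \<longleftrightarrow> real k / n \<le> cdf M x \<and> cdf M x < (real k + 1) / n" for x
    proof -
      have "0 \<le> \<lfloor>real n * cdf M x\<rfloor>" using cdf_nonneg by simp
      then have "quantile_cell n x = k \<longleftrightarrow> \<lfloor>real n * cdf M x\<rfloor> = int k"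
        by (auto simp: quantile_cell_def)
      also have "\<dots> \<longleftrightarrow> real k \<le> real n * cdf M x \<and> real n * cdf M x < real k + 1"
        by (simp add: floor_eq_iff)
      finally show ?thesis using n by (simp add: field_simps)
    qed
    then show ?thesis by auto
  qed
  also have "prob \<dots> \<le> (real k + 1) / n - real k / n"
    by (intro cdf_slab_le cont) (auto simp: divide_right_mono)
  finally show ?thesis by (simp flip: diff_divide_distrib)
qed

text \<open>The union bound runs only over the finitely many cell unions in \<open>run_sets\<close>;
  any union of at most \<open>K\<close> intervals is then sandwiched between two of them. The
  exceptional event is fixed before the family and \<open>l\<close> are chosen.\<close>

lemma interval_family_deviation_event:
  assumes cont: "\<And>x. isCont (cdf M) x" and n: "0 < n" and y: "real (2 * K) / n \<le> y" "0 < y"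
  defines "Q \<equiv> Pi\<^sub>M {1..n} (\<lambda>_. M)"
  shows "\<exists>B\<in>sets Q. measure Q B \<le> real (card (run_sets n (2 * K))) * (2 * exp (- (n * y))) \<and>
    (\<forall>X\<in>space Q - B. \<forall>(C :: real set set) l. finite C \<longrightarrow> card C \<le> K \<longrightarrow> (\<forall>S\<in>C. is_interval S) \<longrightarrow> \<Union>C \<in> sets borel \<longrightarrow>
       0 < l \<longrightarrow> l \<le> 1 \<longrightarrow>
       (\<Sum>i=1..n. indicator (\<Union>C) (X i)) \<le> n * ((1 + l) * prob (\<Union>C) + 4 * y / l) \<and>
       n * ((1 - l) * prob (\<Union>C) - 4 * y / l) \<le> (\<Sum>i=1..n. indicator (\<Union>C) (X i)))"
proof -
  let ?R = "run_sets n (2 * K)" and ?\<kappa> = "quantile_cell n"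
  interpret QQ: prob_space Q unfolding Q_def by (rule prob_space_PiM) (rule prob_space_axioms)
  have ms[measurable]: "?\<kappa> -` J \<in> sets borel" for J
    using measurable_sets[OF measurable_quantile_cell, of J n] by simp
  have "\<forall>J. \<exists>B\<in>sets Q. measure Q B \<le> 2 * exp (- (real n * y)) \<and>
    (\<forall>X\<in>space Q - B. \<forall>l. 0 < l \<longrightarrow> l \<le> 1 \<longrightarrow>
       (\<Sum>i=1..n. indicator (?\<kappa> -` J) (X i)) \<le> n * ((1 + l) * prob (?\<kappa> -` J) + 2 * y / l) \<and>
       n * ((1 - l) * prob (?\<kappa> -` J) - 2 * y / l) \<le> (\<Sum>i=1..n. indicator (?\<kappa> -` J) (X i)))"
    using relative_deviation_event[of "{1..n}" _ y] ms y by (simp add: Q_def)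
  then obtain B where B: "\<And>J. B J \<in> sets Q" "\<And>J. measure Q (B J) \<le> 2 * exp (- (real n * y))"
    and dev: "\<And>J X l. X \<in> space Q - B J \<Longrightarrow> 0 < l \<Longrightarrow> l \<le> 1 \<Longrightarrow>
       (\<Sum>i=1..n. indicator (?\<kappa> -` J) (X i)) \<le> n * ((1 + l) * prob (?\<kappa> -` J) + 2 * y / l) \<and>
       n * ((1 - l) * prob (?\<kappa> -` J) - 2 * y / l) \<le> (\<Sum>i=1..n. indicator (?\<kappa> -` J) (X i))"
    by metis
  show ?thesis
  proof (intro bexI[of _ "\<Union>J\<in>?R. B J"] conjI ballI allI impI)
    have "measure Q (\<Union>J\<in>?R. B J) \<le> (\<Sum>J\<in>?R. measure Q (B J))"
      using B finite_run_sets by (intro measure_UNION_le) auto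
    also have "\<dots> \<le> (\<Sum>J\<in>?R. 2 * exp (- (real n * y)))" by (intro sum_mono B)
    finally show "measure Q (\<Union>J\<in>?R. B J) \<le> real (card ?R) * (2 * exp (- (n * y)))" by simp
    show "(\<Union>J\<in>?R. B J) \<in> sets Q" using B finite_run_sets by auto
    fix X and C :: "real set set" and l :: real
    assume X: "X \<in> space Q - (\<Union>J\<in>?R. B J)" and C: "finite C" "card C \<le> K" "\<forall>S\<in>C. is_interval S"
      and CB: "\<Union>C \<in> sets borel" and l: "0 < l" "l \<le> 1"
    obtain J J' E where J: "J \<in> ?R" "J' \<in> ?R" and E: "finite E" "card E \<le> 2 * K" "J' \<subseteq> J \<union> E"
      and sw: "?\<kappa> -` J \<subseteq> \<Union>C" "\<Union>C \<subseteq> ?\<kappa> -` J'"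
      using interval_family_sandwich[OF mono_quantile_cell quantile_cell_le C(1,2)] C(3) by metis
    \<comment> \<open>The gap between inner and outer set consists of at most \<open>2 * K\<close>
      cells of mass at most \<open>1 / n\<close>.\<close>
    have "prob (?\<kappa> -` E) = prob (\<Union>k\<in>E. ?\<kappa> -` {k})" by (rule arg_cong[where f = prob]) auto
    also have "\<dots> \<le> (\<Sum>k\<in>E. prob (?\<kappa> -` {k}))"
      using E by (intro measure_UNION_le) auto
    also have "\<dots> \<le> (\<Sum>k\<in>E. 1 / real n)" by (intro sum_mono prob_quantile_cell_le cont n)
    also have "\<dots> \<le> real (2 * K) / n"
      using E by (simp add: divide_right_mono)
    also have "\<dots> \<le> y" by fact
    finally have gap: "prob (?\<kappa> -` E) \<le> y" .
    have "prob (?\<kappa> -` J') \<le> prob (?\<kappa> -` J \<union> ?\<kappa> -` E)"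
      using E(3) by (intro finite_measure_mono) auto
    also have "\<dots> \<le> prob (?\<kappa> -` J) + prob (?\<kappa> -` E)"
      by (intro measure_Un_le) auto
    finally have gap': "prob (?\<kappa> -` J') \<le> prob (?\<kappa> -` J) + y" using gap by simp
    have le: "prob (?\<kappa> -` J) \<le> prob (\<Union>C)" "prob (\<Union>C) \<le> prob (?\<kappa> -` J')"
      using sw CB by (auto intro!: finite_measure_mono)
    have yl: "y \<le> y / l" using y l by (simp add: field_simps)
    have w: "2 * y / l = 2 * (y / l)" "4 * y / l = 4 * (y / l)" by simp_all
    have ly: "l * y \<le> y" using y l by simp
    have "(\<Sum>i=1..n. indicator (\<Union>C) (X i)) \<le> (\<Sum>i=1..n. indicator (?\<kappa> -` J') (X i) :: real)"
      using sw(2) by (intro sum_mono) (auto simp: indicator_def)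
    also have "\<dots> \<le> n * ((1 + l) * prob (?\<kappa> -` J') + 2 * y / l)"
      using dev[of X J' l] X J l by auto
    \<comment> \<open>Replacing the outer set by the union costs
      \<open>(1 + l) y \<le> 2 y / l\<close>, so the constant grows from 2 to 4.\<close>
    also have "\<dots> \<le> n * ((1 + l) * prob (\<Union>C) + 4 * y / l)"
    proof (intro mult_left_mono)
      have "(1 + l) * prob (?\<kappa> -` J') \<le> (1 + l) * (prob (\<Union>C) + y)"
        using gap' le l by (intro mult_left_mono) auto
      then show "(1 + l) * prob (?\<kappa> -` J') + 2 * y / l \<le> (1 + l) * prob (\<Union>C) + 4 * y / l"
        using yl ly unfolding w by (simp only: distrib_left distrib_right mult_1)
    qed auto
    finally show "(\<Sum>i=1..n. indicator (\<Union>C) (X i)) \<le> n * ((1 + l) * prob (\<Union>C) + 4 * y / l)" .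
    have "n * ((1 - l) * prob (\<Union>C) - 4 * y / l) \<le> n * ((1 - l) * prob (?\<kappa> -` J) - 2 * y / l)"
    proof (intro mult_left_mono)
      have "(1 - l) * prob (\<Union>C) \<le> (1 - l) * (prob (?\<kappa> -` J) + y)"
        using gap' le l by (intro mult_left_mono) auto
      moreover have "0 \<le> l * y" using l y by simp
      ultimately show "(1 - l) * prob (\<Union>C) - 4 * y / l \<le> (1 - l) * prob (?\<kappa> -` J) - 2 * y / l"
        using yl y(2) unfolding w by (simp only: distrib_left left_diff_distrib mult_1)
    qed auto
    also have "\<dots> \<le> (\<Sum>i=1..n. indicator (?\<kappa> -` J) (X i))"
      using dev[of X J l] X J l by auto
    also have "\<dots> \<le> (\<Sum>i=1..n. indicator (\<Union>C) (X i))"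
      using sw(1) by (intro sum_mono) (auto simp: indicator_def)
    finally show "n * ((1 - l) * prob (\<Union>C) - 4 * y / l) \<le> (\<Sum>i=1..n. indicator (\<Union>C) (X i))" .
  qed
qed

end


subsection \<open>From level sets to functions\<close>

definition unit_lborel :: "real measure" where
  "unit_lborel = density lborel (\<lambda>u. ennreal (indicator {0..1} u))"

lemma prob_space_unit_lborel: "prob_space unit_lborel"
proof
  have "emeasure unit_lborel (space unit_lborel) = (\<integral>\<^sup>+u. indicator {0..1::real} u \<partial>lborel)"
    unfolding unit_lborel_def by (simp add: emeasure_density ennreal_indicator)
  then show "emeasure unit_lborel (space unit_lborel) = 1" by simp
qed

lemma sets_unit_lborel[measurable_cong, simp]: "sets unit_lborel = sets borel"
  by (simp add: unit_lborel_def)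

lemma AE_unit_lborel: "AE u in unit_lborel. 0 < u \<and> u < (1::real)"
proof -
  have "AE u in lborel. 0 < (indicator {0..1} u :: ennreal) \<longrightarrow> 0 < u \<and> u < (1::real)"
    using AE_lborel_singleton[of 0] AE_lborel_singleton[of 1]
    by eventually_elim (auto simp: indicator_def)
  then show ?thesis
    unfolding unit_lborel_def by (subst AE_density) (auto simp: ennreal_indicator)
qed

text \<open>The cut-off at level \<open>a\<close> is the form in which layer-cake integrands
  appear.\<close>

lemma integral_unit_lborel_FTC:
  fixes F f :: "real \<Rightarrow> real"
  assumes a: "0 \<le> a" "a \<le> 1"
    and F: "\<And>u. 0 \<le> u \<Longrightarrow> u \<le> a \<Longrightarrow> (F has_real_derivative f u) (at u)"
    and f: "continuous_on {0..a} f" and [measurable]: "f \<in> borel_measurable borel"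
  shows "(LINT u|unit_lborel. f u * of_bool (u < a)) = F a - F 0"
proof -
  have "(LINT u|unit_lborel. f u * of_bool (u < a)) = (LINT u|lborel. indicator {0..1} u *\<^sub>R (f u * of_bool (u < a)))"
    unfolding unit_lborel_def by (rule integral_density) auto
  also have "\<dots> = (LINT u|lborel. indicator {0..a} u *\<^sub>R f u)"
  proof (rule integral_cong_AE)
    show "AE u in lborel. indicator {0..1} u *\<^sub>R (f u * of_bool (u < a)) = indicator {0..a} u *\<^sub>R f u"
      using AE_lborel_singleton[of a] by eventually_elim (use a in \<open>auto simp: indicator_def\<close>)
  qed auto
  also have "\<dots> = F a - F 0"
    using a F f by (intro integral_FTC_atLeastAtMost)
      (auto simp: has_real_derivative_iff_has_vector_derivative[symmetric] intro: DERIV_subset)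
  finally show ?thesis .
qed

text \<open>For \<open>\<bar>v\<bar> \<le> 1\<close>, \<open>v\<close> is the integral over levels
  \<open>u\<close> of \<open>sgn v\<close> on \<open>u < \<bar>v\<bar>\<close>. The tail bounds are
  applied level by level with \<open>l = L u\<close> and integrated. The relative errors integrate
  to a multiple of \<open>g^2\<close> and \<open>d \<bar>g\<bar>\<close>, the terms
  \<open>c / l\<close> to a logarithm.\<close>

lemma (in real_distribution) layer_cake_deviation:
  fixes g :: "real \<Rightarrow> real" and X :: "nat \<Rightarrow> real"
  assumes g[measurable]: "g \<in> borel_measurable borel" and g1: "\<And>x. \<bar>g x\<bar> \<le> 1"
    and n: "0 < n" and c: "0 \<le> c" and e: "0 < e" "e \<le> 1" and d: "0 < d" "d \<le> 1"
    and up: "\<And>u l. 0 < u \<Longrightarrow> u < 1 \<Longrightarrow> 0 < l \<Longrightarrow> l \<le> 1 \<Longrightarrow>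
      (\<Sum>i=1..n. indicator {x. u < g x} (X i)) \<le> n * ((1 + l) * prob {x. u < g x} + c / l)"
    and low: "\<And>u l. 0 < u \<Longrightarrow> u < 1 \<Longrightarrow> 0 < l \<Longrightarrow> l \<le> 1 \<Longrightarrow>
      n * ((1 - l) * prob {x. g x < - u} - c / l) \<le> (\<Sum>i=1..n. indicator {x. g x < - u} (X i))"
  shows "(\<Sum>i=1..n. g (X i)) \<le>
    n * (expectation g + e / 2 * (expectation (\<lambda>x. (g x)\<^sup>2) + d\<^sup>2) + 4 * c / e * ln ((1 + d) / d))"
proof -
  let ?N = unit_lborel
  interpret N: prob_space ?N by (rule prob_space_unit_lborel)
  interpret P: pair_prob_space M ?N ..
  \<comment> \<open>The part proportional to \<open>u\<close> turns relative errors into a second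
    moment; the shift \<open>d\<close> keeps \<open>1 / L\<close> integrable at 0; the factor 1/2
    keeps \<open>L u \<le> 1\<close>.\<close>
  define L where "L u = e * (u + d) / 2" for u :: real
  \<comment> \<open>The layer with its relative error included: at level \<open>u\<close> it is
    \<open>1 + L u\<close> on \<open>u < v\<close> and \<open>- (1 - L u)\<close> on
    \<open>v < - u\<close>, matching the upper bound for the positive part and the lower bound for
    the negative part.\<close>
  define \<phi> where "\<phi> v u = (sgn v + L u) * of_bool (u < \<bar>v\<bar>)" for v u :: real
  have L[measurable]: "L \<in> borel_measurable borel" unfolding L_def by measurable
  have \<phi>[measurable]: "(\<lambda>(v, u). \<phi> v u) \<in> borel_measurable (borel \<Otimes>\<^sub>M borel)"
    unfolding \<phi>_def by measurable
  have L01: "0 < L u" "L u \<le> 1" if "0 < u" "u < 1" for u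
  proof -
    show "0 < L u" using that e d by (simp add: L_def)
    have "e * (u + d) \<le> 1 * 2" using that e d by (intro mult_mono) auto
    then show "L u \<le> 1" by (simp add: L_def)
  qed
  have int\<phi>: "(LINT u|?N. \<phi> v u) = v + e / 2 * (v\<^sup>2 / 2 + d * \<bar>v\<bar>)" if "\<bar>v\<bar> \<le> 1" for v
  proof -
    have "(LINT u|?N. \<phi> v u) = (sgn v * \<bar>v\<bar> + e / 2 * (\<bar>v\<bar>\<^sup>2 / 2 + d * \<bar>v\<bar>)) - (sgn v * 0 + e / 2 * (0\<^sup>2 / 2 + d * 0))"
      unfolding \<phi>_def
    proof (rule integral_unit_lborel_FTC)
      show "((\<lambda>u. sgn v * u + e / 2 * (u\<^sup>2 / 2 + d * u)) has_real_derivative sgn v + L u) (at u)" for u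
        by (auto simp: L_def intro!: derivative_eq_intros)
      show "continuous_on {0..\<bar>v\<bar>} (\<lambda>u. sgn v + L u)"
        unfolding L_def by (intro continuous_intros) auto
    qed (use that in auto)
    then show ?thesis by (simp add: sgn_mult_abs)
  qed
  have intsgn: "(LINT u|?N. sgn v * of_bool (u < \<bar>v\<bar>)) = v" if "\<bar>v\<bar> \<le> 1" for v
  proof -
    have "(LINT u|?N. sgn v * of_bool (u < \<bar>v\<bar>)) = sgn v * \<bar>v\<bar> - sgn v * 0"
      by (rule integral_unit_lborel_FTC) (use that in \<open>auto intro!: derivative_eq_intros\<close>)
    then show ?thesis by (simp add: sgn_mult_abs)
  qed
  have intL: "(LINT u|?N. 1 / L u) = 2 / e * ln ((1 + d) / d)"
  proof -
    have "(LINT u|?N. 1 / L u) = (LINT u|?N. (1 / L u) * of_bool (u < 1))"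
      using AE_unit_lborel by (intro integral_cong_AE) (auto elim: eventually_mono)
    also have "\<dots> = 2 / e * ln (1 + d) - 2 / e * ln (0 + d)"
    proof (rule integral_unit_lborel_FTC)
      show "((\<lambda>u. 2 / e * ln (u + d)) has_real_derivative 1 / L u) (at u)" if "0 \<le> u" for u
        using that e d by (auto simp: L_def intro!: derivative_eq_intros)
      show "continuous_on {0..1} (\<lambda>u. 1 / L u)"
        using e d unfolding L_def by (intro continuous_intros) auto
    qed auto
    finally show ?thesis using d by (simp add: ln_div algebra_simps)
  qed
  have b\<phi>: "\<bar>\<phi> v u\<bar> \<le> 2" if "0 < u" "u < 1" for v u
  proof -
    have "\<bar>sgn v\<bar> \<le> 1" by (simp add: sgn_if)
    then have "\<bar>sgn v + L u\<bar> \<le> 2" using L01[OF that] by linarith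
    then show ?thesis by (simp add: \<phi>_def)
  qed
  have AEp: "AE p in M \<Otimes>\<^sub>M ?N. 0 < snd p \<and> snd p < 1"
  proof (rule P.AE_pair_measure)
    show "{p \<in> space (M \<Otimes>\<^sub>M ?N). 0 < snd p \<and> snd p < 1} \<in> sets (M \<Otimes>\<^sub>M ?N)"
      by measurable
  qed (use AE_unit_lborel in auto)
  have int_pair: "integrable (M \<Otimes>\<^sub>M ?N) (\<lambda>(x, u). \<phi> (g x) u)"
  proof (rule P.integrable_const_bound[where B = 2])
    show "AE p in M \<Otimes>\<^sub>M ?N. norm (case p of (x, u) \<Rightarrow> \<phi> (g x) u) \<le> 2"
      using AEp by eventually_elim (auto simp: split_beta intro!: b\<phi>)
  qed measurable
  have Fub: "(LINT u|?N. expectation (\<lambda>x. \<phi> (g x) u)) = expectation (\<lambda>x. LINT u|?N. \<phi> (g x) u)"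
    using int_pair by (rule P.Fubini_integral)
  have intE: "integrable ?N (\<lambda>u. expectation (\<lambda>x. \<phi> (g x) u))"
    using P.integrable_snd[OF int_pair] .
  have intinv: "integrable ?N (\<lambda>u. 1 / L u)"
  proof (rule N.integrable_const_bound[where B = "2 / (e * d)"])
    show "AE u in ?N. norm (1 / L u) \<le> 2 / (e * d)"
      using AE_unit_lborel
      by eventually_elim (use e d in \<open>auto simp: L_def intro!: divide_left_mono mult_pos_pos mult_left_mono\<close>)
  qed measurable
  have ints: "integrable ?N (\<lambda>u. sgn v * of_bool (u < \<bar>v\<bar>))" for v :: real
    by (rule N.integrable_const_bound[where B = 1]) (auto simp: sgn_if)
  have ptw: "(\<Sum>i=1..n. sgn (g (X i)) * of_bool (u < \<bar>g (X i)\<bar>))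
      \<le> n * (expectation (\<lambda>x. \<phi> (g x) u) + 2 * c * (1 / L u))" if u: "0 < u" "u < 1" for u
  proof -
    have 1: "sgn v * of_bool (u < \<bar>v\<bar>) = of_bool (u < v) - of_bool (v < - u)" for v :: real
      using u by (auto simp: sgn_if)
    have "\<phi> v u = (1 + L u) * of_bool (u < v) - (1 - L u) * of_bool (v < - u)" for v
      using u by (auto simp: \<phi>_def sgn_if)
    then have "expectation (\<lambda>x. \<phi> (g x) u)
      = expectation (\<lambda>x. (1 + L u) * indicator {x. u < g x} x - (1 - L u) * indicator {x. g x < - u} x)"
      by (simp add: indicator_def)
    also have "\<dots> = (1 + L u) * prob {x. u < g x} - (1 - L u) * prob {x. g x < - u}"
      by (subst Bochner_Integration.integral_diff) (auto simp: less_top[symmetric] intro!: integrable_mult_right integrable_real_indicator)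
    finally have 2: "expectation (\<lambda>x. \<phi> (g x) u) = (1 + L u) * prob {x. u < g x} - (1 - L u) * prob {x. g x < - u}" .
    have "(\<Sum>i=1..n. sgn (g (X i)) * of_bool (u < \<bar>g (X i)\<bar>))
       = (\<Sum>i=1..n. indicator {x. u < g x} (X i)) - (\<Sum>i=1..n. indicator {x. g x < - u} (X i))"
      unfolding 1 by (simp only: sum_subtractf indicator_def mem_Collect_eq)
    also have "\<dots> \<le> n * ((1 + L u) * prob {x. u < g x} + c / L u) - n * ((1 - L u) * prob {x. g x < - u} - c / L u)"
      by (intro diff_mono up low u L01)
    also have "\<dots> = n * (expectation (\<lambda>x. \<phi> (g x) u) + 2 * c * (1 / L u))"
      unfolding 2 by (simp add: algebra_simps)
    finally show ?thesis .
  qed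
  have "(\<Sum>i=1..n. g (X i)) = (LINT u|?N. (\<Sum>i=1..n. sgn (g (X i)) * of_bool (u < \<bar>g (X i)\<bar>)))"
    by (subst Bochner_Integration.integral_sum, rule ints) (simp only: intsgn[OF g1])
  also have "\<dots> \<le> (LINT u|?N. n * (expectation (\<lambda>x. \<phi> (g x) u) + 2 * c * (1 / L u)))"
  proof (rule integral_mono_AE)
    show "integrable ?N (\<lambda>u. \<Sum>i=1..n. sgn (g (X i)) * of_bool (u < \<bar>g (X i)\<bar>))"
      by (intro Bochner_Integration.integrable_sum ints)
    show "integrable ?N (\<lambda>u. n * (expectation (\<lambda>x. \<phi> (g x) u) + 2 * c * (1 / L u)))"
      by (intro integrable_mult_right Bochner_Integration.integrable_add intE intinv)
    show "AE u in ?N. (\<Sum>i=1..n. sgn (g (X i)) * of_bool (u < \<bar>g (X i)\<bar>))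
        \<le> n * (expectation (\<lambda>x. \<phi> (g x) u) + 2 * c * (1 / L u))"
      using AE_unit_lborel by eventually_elim (rule ptw, auto)
  qed
  also have "\<dots> = n * (expectation (\<lambda>x. LINT u|?N. \<phi> (g x) u) + 2 * c * (2 / e * ln ((1 + d) / d)))"
    using intE intinv by (simp only: integral_mult_right_zero Bochner_Integration.integral_add integrable_mult_right Fub intL)
  also have "\<dots> \<le> n * (expectation g + e / 2 * (expectation (\<lambda>x. (g x)\<^sup>2) + d\<^sup>2) + 4 * c / e * ln ((1 + d) / d))"
  proof (intro mult_left_mono)
    have ig: "integrable M g" "integrable M (\<lambda>x. (g x)\<^sup>2)"
      using g1 by (auto intro!: integrable_const_bound[where B = 1] simp: abs_square_le_1)
    have "expectation (\<lambda>x. LINT u|?N. \<phi> (g x) u) = expectation (\<lambda>x. g x + e / 2 * ((g x)\<^sup>2 / 2 + d * \<bar>g x\<bar>))"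
      using g1 by (simp add: int\<phi>)
    also have "\<dots> \<le> expectation (\<lambda>x. g x + e / 2 * ((g x)\<^sup>2 + d\<^sup>2))"
    proof (rule integral_mono)
      show "g x + e / 2 * ((g x)\<^sup>2 / 2 + d * \<bar>g x\<bar>) \<le> g x + e / 2 * ((g x)\<^sup>2 + d\<^sup>2)" for x
      proof -
        \<comment> \<open>The first-moment term \<open>d \<bar>g\<bar>\<close> is traded for a
          second moment plus \<open>d^2\<close>.\<close>
        have "0 \<le> (d - \<bar>g x\<bar>)\<^sup>2" by simp
        then have "2 * (d * \<bar>g x\<bar>) \<le> (g x)\<^sup>2 + d\<^sup>2" by (simp add: power2_diff)
        moreover have "0 \<le> d\<^sup>2" by simp
        ultimately have "(g x)\<^sup>2 / 2 + d * \<bar>g x\<bar> \<le> (g x)\<^sup>2 + d\<^sup>2" by linarith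
        then show ?thesis using e by (intro add_left_mono mult_left_mono) auto
      qed
    qed (use ig in auto)
    also have "\<dots> = expectation g + e / 2 * (expectation (\<lambda>x. (g x)\<^sup>2) + d\<^sup>2)"
      using ig prob_space by simp
    finally show "expectation (\<lambda>x. LINT u|?N. \<phi> (g x) u) + 2 * c * (2 / e * ln ((1 + d) / d))
      \<le> expectation g + e / 2 * (expectation (\<lambda>x. (g x)\<^sup>2) + d\<^sup>2) + 4 * c / e * ln ((1 + d) / d)" by simp
  qed auto
  finally show ?thesis .
qed


subsection \<open>Scores against a step density\<close>

lemma step_density_pieces:
  assumes "t \<in> step_densities D"
  shows "\<exists>P :: nat \<Rightarrow> real set. (\<forall>y. \<exists>j\<le>Suc D. y \<in> P j) \<and>
     (\<forall>j\<le>Suc D. is_interval (P j) \<and> (\<exists>b\<ge>0. \<forall>y\<in>P j. t y = b))"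
proof -
  obtain x a :: "nat \<Rightarrow> real" where x: "strict_mono_on {1..D + 1} x" and a: "\<forall>j\<in>{1..D}. 0 \<le> a j"
    and t: "t = (\<lambda>y. \<Sum>j=1..D. a j * indicator {x j<..x (j + 1)} y)"
    using assms by (auto simp: step_densities_def)
  have x_le: "x k \<le> x l" if "1 \<le> k" "k \<le> l" "l \<le> Suc D" for k l
    using that strict_mono_on_leD[OF x, of k l] by simp
  \<comment> \<open>The \<open>D\<close> steps together with the two unbounded pieces on which the
    density vanishes, indexed 0 and \<open>D + 1\<close>.\<close>
  define P where "P j = (if j = 0 then {..x 1} else if j \<le> D then {x j<..x (j + 1)} else {x (D + 1)<..})" for j
  have cover: "\<exists>j\<le>Suc D. y \<in> P j" for y
  proof (cases "y \<le> x 1")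
    case False
    \<comment> \<open>The last breakpoint strictly left of \<open>y\<close>, since the pieces are
      open on the left.\<close>
    define j where "j = Max {j \<in> {1..Suc D}. x j < y}"
    have fin: "finite {j \<in> {1..Suc D}. x j < y}" and ne: "{j \<in> {1..Suc D}. x j < y} \<noteq> {}"
      using False by (auto intro!: exI[of _ 1])
    have j: "1 \<le> j" "j \<le> Suc D" "x j < y" using Max_in[OF fin ne] by (auto simp: j_def)
    have "y \<le> x (j + 1)" if "j \<le> D"
    proof (rule ccontr)
      assume "\<not> y \<le> x (j + 1)"
      then have "j + 1 \<in> {j \<in> {1..Suc D}. x j < y}" using that by auto
      then have "j + 1 \<le> j" using Max_ge[OF fin] by (simp only: j_def)
      then show False by simp
    qed
    moreover have "x (D + 1) < y" if "\<not> j \<le> D"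
    proof -
      have "j = D + 1" using that j(2) by linarith
      then show ?thesis using j(3) by simp
    qed
    ultimately have "y \<in> P j" using j by (auto simp: P_def)
    then show ?thesis using j by auto
  qed (auto simp: P_def intro!: exI[of _ 0])
  have ivl: "is_interval (P j)" for j by (auto simp: P_def is_interval_1)
  have const: "\<exists>b\<ge>0. \<forall>y\<in>P j. t y = b" for j
  proof (cases "1 \<le> j \<and> j \<le> D")
    case True
    have "t y = a j" if y: "y \<in> P j" for y
    proof -
      have yj: "x j < y" "y \<le> x (j + 1)" using y True by (auto simp: P_def)
      have "indicator {x k<..x (k + 1)} y = (if k = j then 1 else 0 :: real)" if k: "k \<in> {1..D}" for k
      proof (cases k j rule: linorder_cases)
        case less
        then have "x (k + 1) \<le> x j" using True k by (intro x_le) auto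
        then show ?thesis using yj less by auto
      next
        case greater
        then have "x (j + 1) \<le> x k" using True k by (intro x_le) auto
        then show ?thesis using yj greater by auto
      qed (use yj in auto)
      then have "t y = (\<Sum>k=1..D. a k * (if k = j then 1 else 0))"
        unfolding t by (intro sum.cong refl arg_cong2[where f = "(*)"]) auto
      also have "\<dots> = (\<Sum>k=1..D. if k = j then a k else 0)" by (intro sum.cong) auto
      also have "\<dots> = a j" using True by simp
      finally show ?thesis .
    qed
    then show ?thesis using a True by auto
  next
    case False
    have "t y = 0" if y: "y \<in> P j" for y
    proof -
      have "indicator {x k<..x (k + 1)} y = (0 :: real)" if k: "k \<in> {1..D}" for k
      proof (cases "j = 0")
        case True
        then have "y \<le> x 1" using y by (simp add: P_def)
        also have "x 1 \<le> x k" using k by (intro x_le) auto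
        finally show ?thesis by auto
      next
        case j0: False
        then have "x (D + 1) < y" using y False by (auto simp: P_def)
        moreover have "x (k + 1) \<le> x (D + 1)" using k by (intro x_le) auto
        ultimately show ?thesis by auto
      qed
      then show ?thesis unfolding t by simp
    qed
    then show ?thesis by auto
  qed
  show ?thesis using cover ivl const by blast
qed

text \<open>On a piece where \<open>v\<close> is constant the score is increasing in
  \<open>t x\<close>, so it inherits the monotonicity of \<open>t\<close>. Cutting the
  \<open>D + 2\<close> pieces at the left end \<open>x0\<close> of the support isolates the upward
  jump of \<open>t\<close> there.\<close>

lemma score_antimono_cover:
  assumes v: "v \<in> step_densities D" and t: "t \<in> decreasing_densities"
  shows "\<exists>C. finite C \<and> card C \<le> 2 * (D + 2) \<and> \<Union>C = UNIV \<and>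
    (\<forall>S\<in>C. is_interval S \<and> antimono_on S (\<lambda>x. score (v x) (t x)))"
proof -
  obtain P :: "nat \<Rightarrow> real set" where cover: "\<And>y. \<exists>j\<le>Suc D. y \<in> P j"
    and P: "\<And>j. j \<le> Suc D \<Longrightarrow> is_interval (P j)" "\<And>j. j \<le> Suc D \<Longrightarrow> \<exists>b\<ge>0. \<forall>y\<in>P j. v y = b"
    using step_density_pieces[OF v] by metis
  obtain x0 f where f: "\<forall>y\<in>{x0<..}. 0 \<le> f y" "antimono_on {x0<..} f"
    and t_eq: "t = (\<lambda>y. f y * indicator {x0<..} y)"
    using t by (auto simp: decreasing_densities_def)
  define C where "C = (\<lambda>(j, H). P j \<inter> H) ` ({..Suc D} \<times> {{..x0}, {x0<..}})"
  have "card C \<le> card ({..Suc D} \<times> {{..x0}, {x0<..}})"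
    unfolding C_def by (intro card_image_le) auto
  also have "\<dots> \<le> (D + 2) * 2" by (simp add: card_cartesian_product card_insert_if)
  finally have card: "card C \<le> 2 * (D + 2)" by simp
  have "y \<in> \<Union>C" for y
  proof -
    obtain j where "j \<le> Suc D" "y \<in> P j" using cover by blast
    then show ?thesis by (cases "y \<le> x0") (auto simp: C_def)
  qed
  moreover have "is_interval S \<and> antimono_on S (\<lambda>x. score (v x) (t x))" if SC: "S \<in> C" for S
  proof -
    obtain j H where j: "j \<le> Suc D" and H: "H = {..x0} \<or> H = {x0<..}" and S: "S = P j \<inter> H"
      using SC by (auto simp: C_def)
    have "is_interval S"
      unfolding S using P(1)[OF j] H by (intro is_interval_Int) auto
    moreover obtain b where b: "b \<ge> 0" "\<forall>y\<in>P j. v y = b" using P(2)[OF j] by blast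
    have "score (v y) (t y) \<le> score (v x) (t x)" if xy: "x \<in> S" "y \<in> S" "x \<le> y" for x y
      using H
    proof
      assume "H = {..x0}"
      then show ?thesis using xy b by (auto simp: S t_eq)
    next
      assume "H = {x0<..}"
      moreover from this have "f y \<le> f x"
        using f(2) xy by (auto simp: S monotone_on_def)
      ultimately show ?thesis using xy b f(1) by (auto simp: S t_eq intro!: score_mono)
    qed
    ultimately show ?thesis by (auto simp: monotone_on_def)
  qed
  ultimately show ?thesis
    using card by (intro exI[of _ C]) (auto simp: C_def)
qed

text \<open>On an interval where \<open>g\<close> is antitone, a level set is an initial or a final
  segment, hence again an interval.\<close>

lemma antimono_level_sets:
  fixes g :: "real \<Rightarrow> real"
  assumes "finite C" "card C \<le> K" "\<Union>C = UNIV" "\<And>S. S \<in> C \<Longrightarrow> is_interval S \<and> antimono_on S g"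
  shows "\<exists>C'. finite C' \<and> card C' \<le> K \<and> (\<forall>S\<in>C'. is_interval S) \<and> \<Union>C' = {x. u < g x}"
    and "\<exists>C'. finite C' \<and> card C' \<le> K \<and> (\<forall>S\<in>C'. is_interval S) \<and> \<Union>C' = {x. g x < u}"
proof -
  have K: "card ((\<lambda>S. S \<inter> A) ` C) \<le> K" for A
    using card_image_le[OF assms(1)] assms(2) order_trans by blast
  have U: "\<Union>((\<lambda>S. S \<inter> A) ` C) = A" for A using assms(3) by blast
  have mono: "g y \<le> g x" if "S \<in> C" "x \<in> S" "y \<in> S" "x \<le> y" for S x y
    using assms(4)[OF that(1)] that by (auto simp: monotone_on_def)
  have conv: "y \<in> S" if "S \<in> C" "x \<in> S" "z \<in> S" "x \<le> y" "y \<le> z" for S x y z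
    using assms(4)[OF that(1)] that unfolding is_interval_1 by blast
  have "is_interval (S \<inter> {x. u < g x})" if "S \<in> C" for S
    unfolding is_interval_1
  proof (intro ballI allI impI)
    fix p q z assume "p \<in> S \<inter> {x. u < g x}" "q \<in> S \<inter> {x. u < g x}" "p \<le> z \<and> z \<le> q"
    then show "z \<in> S \<inter> {x. u < g x}"
      using conv[OF that, of p q z] mono[OF that, of p z] mono[OF that, of z q] by auto
  qed
  then show "\<exists>C'. finite C' \<and> card C' \<le> K \<and> (\<forall>S\<in>C'. is_interval S) \<and> \<Union>C' = {x. u < g x}"
    using assms(1) K U by (intro exI[of _ "(\<lambda>S. S \<inter> {x. u < g x}) ` C"]) auto
  have "is_interval (S \<inter> {x. g x < u})" if "S \<in> C" for S
    unfolding is_interval_1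
  proof (intro ballI allI impI)
    fix p q z assume "p \<in> S \<inter> {x. g x < u}" "q \<in> S \<inter> {x. g x < u}" "p \<le> z \<and> z \<le> q"
    then show "z \<in> S \<inter> {x. g x < u}"
      using conv[OF that, of p q z] mono[OF that, of p z] mono[OF that, of z q] by auto
  qed
  then show "\<exists>C'. finite C' \<and> card C' \<le> K \<and> (\<forall>S\<in>C'. is_interval S) \<and> \<Union>C' = {x. g x < u}"
    using assms(1) K U by (intro exI[of _ "(\<lambda>S. S \<inter> {x. g x < u}) ` C"]) auto
qed


section \<open>Deviation of the test statistic at a fixed step density\<close>

lemma rho_T_eq:
  assumes "t \<in> densities" "t' \<in> densities"
  shows "rho_T n X t t' = real n / 2 * midpoint_gap t t' + 1 / sqrt 2 * (\<Sum>i=1..n. score (t (X i)) (t' (X i)))"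
  using densitiesD(2)[OF assms(1)] densitiesD(2)[OF assms(2)]
  by (simp add: rho_T_def midpoint_gap_def psi_sqrt_ratio add.commute)

lemma real_distribution_density:
  assumes "s \<in> densities"
  shows "real_distribution (density lborel (\<lambda>x. ennreal (s x)))"
proof -
  note s = densitiesD[OF assms]
  note [measurable] = s(1)
  have "(\<integral>\<^sup>+x. ennreal (s x) \<partial>lborel) = 1" using assms by (simp add: densities_def)
  then have "prob_space (density lborel (\<lambda>x. ennreal (s x)))"
    by (intro prob_spaceI) (simp add: emeasure_density)
  then show ?thesis by (simp add: real_distribution_def real_distribution_axioms_def)
qed

lemma isCont_cdf_density:
  assumes "s \<in> densities"
  shows "isCont (cdf (density lborel (\<lambda>x. ennreal (s x)))) x"
proof -
  note s = densitiesD[OF assms]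
  note [measurable] = s(1)
  interpret real_distribution "density lborel (\<lambda>x. ennreal (s x))" by (rule real_distribution_density[OF assms])
  have "AE y in lborel. y \<noteq> x" by (rule AE_lborel_singleton)
  then have "(\<integral>\<^sup>+y. ennreal (s y) * indicator {x} y \<partial>lborel) = 0"
    by (subst nn_integral_0_iff_AE) (auto elim!: eventually_mono simp: indicator_def)
  then have "emeasure (density lborel (\<lambda>x. ennreal (s x))) {x} = 0"
    by (simp add: emeasure_density)
  then show ?thesis by (simp add: isCont_cdf measure_def)
qed

lemma log_plus_ge: "1 \<le> log_plus x" "ln x \<le> log_plus x"
  by (auto simp: log_plus_def)

lemma le_exp_log_plus:
  assumes "0 < x"
  shows "x \<le> exp (log_plus x)"
  using assms log_plus_ge(2)[of x] by (metis exp_ge_zero exp_le_cancel_iff exp_ln)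

text \<open>Choosing the weight \<open>x = D / n\<close> bounds the log-cardinality by
  \<open>12 D L + 3 D L\<close>. The exponent \<open>16 D L\<close> leaves
  \<open>exp (- D L)\<close>, which is at most \<open>D / n\<close>.\<close>

lemma card_run_sets_exp_le:
  assumes D: "1 \<le> D" "D \<le> n"
  defines "L \<equiv> log_plus (real n / real D)"
  shows "real (card (run_sets n (2 * (6 * D)))) * (2 * exp (- (real n * (16 * real D * L / n)))) \<le> 2 * real D / real n"
proof -
  define x where "x = real D / real n"
  have n: "0 < real n" "0 < real D" "1 \<le> n" using D by auto
  have x: "0 < x" "x \<le> 1" "1 / x = real n / real D" using D n by (auto simp: x_def)
  have L: "1 \<le> L" by (simp add: L_def log_plus_ge)
  have xL: "1 / x \<le> exp L" unfolding x(3) L_def using n by (intro le_exp_log_plus) auto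
  have "(1 / x) ^ (12 * D) \<le> (exp L) ^ (12 * D)"
    using x xL by (intro power_mono) auto
  also have "\<dots> = exp (12 * real D * L)" by (simp flip: exp_of_nat_mult)
  finally have 1: "(1 / x) ^ (12 * D) \<le> exp (12 * real D * L)" .
  have "(1 + x) ^ (n + 2) \<le> (exp x) ^ (n + 2)"
    using x by (intro power_mono exp_ge_add_one_self) auto
  also have "\<dots> = exp (real (n + 2) * x)" by (simp only: exp_of_nat_mult)
  also have "\<dots> \<le> exp (3 * real D * L)"
  proof -
    have "real (n + 2) * x = real D * (real (n + 2) / n)" by (simp add: x_def)
    also have "\<dots> \<le> real D * 3" using n by (intro mult_left_mono) (auto simp: field_simps)
    also have "\<dots> \<le> real D * 3 * L" using L by (simp add: mult_le_cancel_left1)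
    finally show ?thesis by (simp add: mult_ac)
  qed
  finally have 2: "(1 + x) ^ (n + 2) \<le> exp (3 * real D * L)" .
  have "real (card (run_sets n (2 * (6 * D)))) \<le> (1 / x) ^ (12 * D) * (1 + x) ^ (n + 2)"
    using card_run_sets_le[OF x(1,2), of n "2 * (6 * D)"] by (simp add: mult.assoc[symmetric])
  also have "\<dots> \<le> exp (12 * real D * L) * exp (3 * real D * L)"
    using x by (intro mult_mono 1 2) auto
  finally have "real (card (run_sets n (2 * (6 * D)))) * (2 * exp (- (real n * (16 * real D * L / n))))
      \<le> exp (12 * real D * L) * exp (3 * real D * L) * (2 * exp (- (real n * (16 * real D * L / n))))"
    by (intro mult_right_mono) auto
  also have "\<dots> = 2 * exp (- (real D * L))"
    using n by (simp add: exp_add[symmetric])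
  also have "\<dots> \<le> 2 * exp (- L)"
    using L D by (simp add: mult_le_cancel_right1)
  also have "\<dots> \<le> 2 * real D / real n"
    using xL x(1) n by (simp add: exp_minus field_simps x_def)
  finally show ?thesis .
qed

lemma ln_one_plus_inverse_sqrt_le:
  assumes "0 < x" "x \<le> (1 :: real)"
  shows "ln ((1 + sqrt x) / sqrt x) \<le> 2 * log_plus (1 / x)"
proof -
  have sx: "0 < sqrt x" "sqrt x \<le> 1" using assms by auto
  have "ln ((1 + sqrt x) / sqrt x) \<le> ln (2 / sqrt x)"
    using sx by (subst ln_le_cancel_iff) (auto intro!: divide_right_mono divide_pos_pos add_pos_pos)
  also have "\<dots> = ln 2 + ln (1 / x) / 2"
    using assms sx by (simp add: ln_div ln_sqrt)
  also have "\<dots> \<le> 1 + log_plus (1 / x) / 2"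
    using log_plus_ge(2)[of "1 / x"] ln_add_one_self_le_self[of 1] by (intro add_mono) auto
  also have "\<dots> \<le> 2 * log_plus (1 / x)" using log_plus_ge(1)[of "1 / x"] by simp
  finally show ?thesis .
qed

text \<open>Uniformity in \<open>t\<close> holds because the event controls all unions of at most
  \<open>6 * D\<close> intervals, among them every level set of every score against
  \<open>v\<close>. Expectation and second moment of the score are then replaced by Hellinger
  distances.\<close>

lemma score_deviation_event:
  assumes s: "s \<in> densities" and v: "v \<in> step_densities D" and D: "1 \<le> D" "D \<le> n"
  defines "L \<equiv> log_plus (real n / real D)"
  shows "\<exists>B\<in>sets (sample_law n s). measure (sample_law n s) B \<le> 2 * real D / real n \<and>
    (\<forall>X\<in>space (sample_law n s) - B. \<forall>t\<in>decreasing_densities.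
       rho_T n X v t \<le> real n * (2 * (hellinger s v)\<^sup>2 - (hellinger s t)\<^sup>2 / 8 + 10241 * (real D / real n * L ^ 3)))"
proof -
  define M where "M = density lborel (\<lambda>x. ennreal (s x))"
  interpret real_distribution M unfolding M_def by (rule real_distribution_density[OF s])
  have Q: "sample_law n s = Pi\<^sub>M {1..n} (\<lambda>_. M)" by (simp add: sample_law_def M_def)
  have n: "0 < n" "0 < real n" "0 < real D" using D by auto
  have L: "1 \<le> L" by (simp add: L_def log_plus_ge)
  \<comment> \<open>Large enough both for the union bound over \<open>run_sets\<close> and to
    dominate the mass \<open>12 D / n\<close> of the end cells.\<close>
  define y where "y = 16 * real D * L / n"
  have y: "0 < y" using n L by (simp add: y_def)
  have "real (2 * (6 * D)) \<le> 16 * real D * L"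
  proof -
    have "real (2 * (6 * D)) \<le> 16 * real D * 1" by simp
    also have "\<dots> \<le> 16 * real D * L" using L by (intro mult_left_mono) auto
    finally show ?thesis .
  qed
  then have Ky: "real (2 * (6 * D)) / n \<le> y" unfolding y_def by (intro divide_right_mono) auto
  have vd: "v \<in> densities" using v by (simp add: step_densities_def)
  have cont: "isCont (cdf M) x" for x unfolding M_def by (rule isCont_cdf_density[OF s])
  obtain B where B: "B \<in> sets (sample_law n s)"
    "measure (sample_law n s) B \<le> real (card (run_sets n (2 * (6 * D)))) * (2 * exp (- (n * y)))"
    and dev: "\<And>X C l. X \<in> space (sample_law n s) - B \<Longrightarrow> finite C \<Longrightarrow> card C \<le> 6 * D \<Longrightarrow>
       \<forall>S\<in>C. is_interval S \<Longrightarrow> \<Union>C \<in> sets borel \<Longrightarrow> 0 < l \<Longrightarrow> l \<le> 1 \<Longrightarrow>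
       (\<Sum>i=1..n. indicator (\<Union>C) (X i)) \<le> n * ((1 + l) * prob (\<Union>C) + 4 * y / l) \<and>
       n * ((1 - l) * prob (\<Union>C) - 4 * y / l) \<le> (\<Sum>i=1..n. indicator (\<Union>C) (X i))"
    using interval_family_deviation_event[OF cont n(1) Ky y] unfolding Q by metis
  have "measure (sample_law n s) B \<le> 2 * real D / real n"
    using B(2) card_run_sets_exp_le[OF D] unfolding y_def L_def by linarith
  moreover have "rho_T n X v t \<le> real n * (2 * (hellinger s v)\<^sup>2 - (hellinger s t)\<^sup>2 / 8 + 10241 * (real D / real n * L ^ 3))"
    if X: "X \<in> space (sample_law n s) - B" and t: "t \<in> decreasing_densities" for X t
  proof -
    have td: "t \<in> densities" using t by (simp add: decreasing_densities_def)
    note sm = densitiesD[OF s] and vm = densitiesD[OF vd] and tm = densitiesD[OF td]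
    note [measurable] = sm(1) vm(1) tm(1)
    define g where "g = (\<lambda>x. score (v x) (t x))"
    have g[measurable]: "g \<in> borel_measurable borel" unfolding g_def by measurable
    have g1: "\<bar>g x\<bar> \<le> 1" for x using vm tm by (simp add: g_def abs_score_le_1)
    obtain C where C: "finite C" "card C \<le> 2 * (D + 2)" "\<Union>C = UNIV"
      "\<And>S. S \<in> C \<Longrightarrow> is_interval S \<and> antimono_on S g"
      using score_antimono_cover[OF v t] unfolding g_def by blast
    have CK: "card C \<le> 6 * D" using C(2) D by simp
    \<comment> \<open>With this choice \<open>\<delta>^2\<close> is of the target order and the
      logarithm of \<open>1 / \<delta>\<close> is of order \<open>L\<close>.\<close>
    define \<delta> where "\<delta> = sqrt (real D / real n)"
    have \<delta>: "0 < \<delta>" "\<delta> \<le> 1" "\<delta>\<^sup>2 = real D / real n" using D n by (auto simp: \<delta>_def)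
    \<comment> \<open>The value \<open>e = 1 / 20\<close> gives the second moment the coefficient
      1/40; as that moment is at most 6 times the squared distances, the loss is 3/20, below the
      gain of the test.\<close>
    have "(\<Sum>i=1..n. g (X i)) \<le>
      n * (expectation g + (1 / 20) / 2 * (expectation (\<lambda>x. (g x)\<^sup>2) + \<delta>\<^sup>2) + 4 * (4 * y) / (1 / 20) * ln ((1 + \<delta>) / \<delta>))"
    proof (rule layer_cake_deviation[OF g g1 n(1)])
      fix u l :: real assume ul: "0 < u" "u < 1" "0 < l" "l \<le> 1"
      obtain C' where "finite C'" "card C' \<le> 6 * D" "\<forall>S\<in>C'. is_interval S" "\<Union>C' = {x. u < g x}"
        using antimono_level_sets(1)[OF C(1) CK C(3,4), of u] by blast
      then show "(\<Sum>i=1..n. indicator {x. u < g x} (X i)) \<le> n * ((1 + l) * prob {x. u < g x} + 4 * y / l)"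
        using dev[OF X, of C' l] ul by auto
      obtain C' where "finite C'" "card C' \<le> 6 * D" "\<forall>S\<in>C'. is_interval S" "\<Union>C' = {x. g x < - u}"
        using antimono_level_sets(2)[OF C(1) CK C(3,4), of "- u"] by blast
      then show "n * ((1 - l) * prob {x. g x < - u} - 4 * y / l) \<le> (\<Sum>i=1..n. indicator {x. g x < - u} (X i))"
        using dev[OF X, of C' l] ul by auto
    qed (use y \<delta> in auto)
    also have "\<dots> \<le> n * (expectation g + 1 / 40 * expectation (\<lambda>x. (g x)\<^sup>2) + 10241 * (real D / real n * L ^ 3))"
    proof (intro mult_left_mono)
      \<comment> \<open>The constant is \<open>320 * 16 * 2 = 10240\<close>, and one more unit
        covers the \<open>\<delta>^2\<close> term. The order reached is \<open>L ^ 2\<close>,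
        enlarged to \<open>L ^ 3\<close>.\<close>
      have "ln ((1 + \<delta>) / \<delta>) \<le> 2 * L"
        using ln_one_plus_inverse_sqrt_le[of "real D / real n"] D n by (simp add: \<delta>_def L_def)
      then have "320 * y * ln ((1 + \<delta>) / \<delta>) \<le> 320 * y * (2 * L)"
        using y by (intro mult_left_mono) auto
      also have "\<dots> = 10240 * (real D / real n * L ^ 2)" by (simp add: y_def power2_eq_square)
      also have "\<dots> \<le> 10240 * (real D / real n * L ^ 3)"
        using L by (intro mult_left_mono power_increasing) auto
      finally have 1: "320 * y * ln ((1 + \<delta>) / \<delta>) \<le> 10240 * (real D / real n * L ^ 3)" .
      have "real D / real n * 1 \<le> real D / real n * L ^ 3"
        using L by (intro mult_left_mono one_le_power) auto
      moreover have "0 \<le> real D / real n" by simp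
      ultimately have "1 / 40 * (real D / real n) \<le> real D / real n * L ^ 3" by linarith
      then show "expectation g + (1 / 20) / 2 * (expectation (\<lambda>x. (g x)\<^sup>2) + \<delta>\<^sup>2) + 4 * (4 * y) / (1 / 20) * ln ((1 + \<delta>) / \<delta>)
         \<le> expectation g + 1 / 40 * expectation (\<lambda>x. (g x)\<^sup>2) + 10241 * (real D / real n * L ^ 3)"
      proof -
        have "E + (1 / 20) / 2 * (F + x) + 4 * (4 * y) / (1 / 20) * l \<le> E + 1 / 40 * F + 10241 * z"
          if "320 * y * l \<le> 10240 * z" "1 / 40 * x \<le> z" for E F x l z :: real
          using that by (simp add: algebra_simps add_divide_distrib)
        then show ?thesis using 1 \<open>1 / 40 * (real D / real n) \<le> _\<close> unfolding \<delta>(3) by blast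
      qed
    qed auto
    finally have sum: "(\<Sum>i=1..n. g (X i)) \<le> n * (expectation g + 1 / 40 * expectation (\<lambda>x. (g x)\<^sup>2) + 10241 * (real D / real n * L ^ 3))" .
    have Eg: "expectation g = (LINT x|lborel. g x * s x)" "expectation (\<lambda>x. (g x)\<^sup>2) = (LINT x|lborel. (g x)\<^sup>2 * s x)"
      unfolding M_def using sm by (subst integral_density; simp add: mult.commute)+
    have E1: "midpoint_gap v t / 2 + expectation g / sqrt 2
        \<le> (1 + sqrt 2 / 2) * (hellinger s v)\<^sup>2 - (1 - sqrt 2 / 2) * (hellinger s t)\<^sup>2"
      unfolding Eg using score_test_expectation[OF s vd td] by (simp add: g_def)
    have E2: "expectation (\<lambda>x. (g x)\<^sup>2) \<le> 6 * ((hellinger s v)\<^sup>2 + (hellinger s t)\<^sup>2)"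
      unfolding Eg using score_sq_expectation[OF s vd td] by (simp add: g_def)
    define a b where "a = (hellinger s v)\<^sup>2" and "b = (hellinger s t)\<^sup>2"
    define R where "R = 1 / 40 * expectation (\<lambda>x. (g x)\<^sup>2) + 10241 * (real D / real n * L ^ 3)"
    have ab: "0 \<le> a" "0 \<le> b" by (auto simp: a_def b_def)
    have R0: "0 \<le> R" unfolding R_def using L by (intro add_nonneg_nonneg mult_nonneg_nonneg) auto
    \<comment> \<open>This yields the coefficients 1.71 and 0.29; with the loss 3/20 they become
      1.86 \<le> 2 and 0.14 \<ge> 1/8.\<close>
    have s2: "sqrt 2 \<le> 1.42" by (rule real_le_lsqrt) (auto simp: power2_eq_square)
    have "rho_T n X v t = n / 2 * midpoint_gap v t + (\<Sum>i=1..n. g (X i)) / sqrt 2"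
      by (simp add: rho_T_eq[OF vd td] g_def)
    also have "\<dots> \<le> n / 2 * midpoint_gap v t + n * (expectation g + R) / sqrt 2"
      using sum by (intro add_left_mono divide_right_mono) (auto simp: R_def add.assoc)
    also have "\<dots> = n * (midpoint_gap v t / 2 + expectation g / sqrt 2 + R / sqrt 2)"
      by (simp add: field_simps)
    also have "\<dots> \<le> n * (2 * a - b / 8 + 10241 * (real D / real n * L ^ 3))"
    proof (intro mult_left_mono)
      have "R / sqrt 2 \<le> R / 1" using R0 by (intro divide_left_mono) auto
      also have "\<dots> \<le> 3 / 20 * (a + b) + 10241 * (real D / real n * L ^ 3)"
        using E2 by (simp add: R_def a_def b_def)
      finally have R': "R / sqrt 2 \<le> 3 / 20 * (a + b) + 10241 * (real D / real n * L ^ 3)" .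
      have "(1 + sqrt 2 / 2) * a \<le> 171 / 100 * a" "29 / 100 * b \<le> (1 - sqrt 2 / 2) * b"
        by (rule mult_right_mono, use s2 ab in simp, use ab in simp)+
      then have "midpoint_gap v t / 2 + expectation g / sqrt 2 \<le> 171 / 100 * a - 29 / 100 * b"
        using E1 unfolding a_def[symmetric] b_def[symmetric] by (meson diff_mono order_trans)
      moreover have "p + q \<le> 2 * a - b / 8 + 10241 * z"
        if "p \<le> 171 / 100 * a - 29 / 100 * b" "q \<le> 3 / 20 * (a + b) + 10241 * z" for p q z
        using that ab by (simp add: field_simps)
      ultimately show "midpoint_gap v t / 2 + expectation g / sqrt 2 + R / sqrt 2
          \<le> 2 * a - b / 8 + 10241 * (real D / real n * L ^ 3)"
        using R' by blast
    qed auto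
    finally show ?thesis unfolding a_def b_def .
  qed
  ultimately show ?thesis using B(1) by blast
qed


subsection \<open>Risk of the estimator\<close>

text \<open>The test statistic evaluates densities at sample points, so Hellinger convergence alone
  does not suffice. It is L1 convergence of the squared root differences, and a subsequence
  converges almost everywhere.\<close>

lemma hellinger_closure_AE_sequence:
  assumes v: "v \<in> hellinger_closure S" and S: "S \<subseteq> densities"
  shows "\<exists>u. (\<forall>m. u m \<in> S) \<and> (\<lambda>m. hellinger v (u m)) \<longlonglongrightarrow> 0 \<and> (AE x in lborel. (\<lambda>m. u m x) \<longlonglongrightarrow> v x)"
proof -
  have vd: "v \<in> densities" and "\<forall>m. \<exists>u\<in>S. hellinger v u < 1 / real (Suc m)"
    using v by (auto simp: hellinger_closure_def)
  then obtain u where u: "\<And>m. u m \<in> S" "\<And>m. hellinger v (u m) < 1 / real (Suc m)" by metis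
  have ud: "u m \<in> densities" for m using u(1) S by blast
  have lim: "(\<lambda>m. hellinger v (u m)) \<longlonglongrightarrow> 0"
  proof (rule tendsto_sandwich[OF _ _ tendsto_const])
    show "eventually (\<lambda>m. hellinger v (u m) \<le> 1 / real (Suc m)) sequentially"
      using u(2) by (intro always_eventually) (auto intro: less_imp_le)
    show "(\<lambda>m. 1 / real (Suc m)) \<longlonglongrightarrow> 0" by (rule LIMSEQ_Suc[OF lim_1_over_n])
  qed (auto simp: hellinger_nonneg)
  have "(\<lambda>m. 2 * (hellinger v (u m))\<^sup>2) \<longlonglongrightarrow> 2 * 0\<^sup>2"
    by (intro tendsto_intros lim)
  then have "(\<lambda>m. LINT x|lborel. norm ((sqrt (v x) - sqrt (u m x))\<^sup>2)) \<longlonglongrightarrow> 0"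
    by (simp add: hellinger_sq)
  then obtain r where r: "strict_mono r" "AE x in lborel. (\<lambda>m. (sqrt (v x) - sqrt (u (r m) x))\<^sup>2) \<longlonglongrightarrow> 0"
    using tendsto_L1_AE_subseq[of lborel "\<lambda>m x. (sqrt (v x) - sqrt (u m x))\<^sup>2"]
      integrable_sqrt_diff_sq[OF vd ud] by blast
  have "AE x in lborel. (\<lambda>m. u (r m) x) \<longlonglongrightarrow> v x"
    using r(2)
  proof eventually_elim
    case (elim x)
    then have "(\<lambda>m. sqrt ((sqrt (v x) - sqrt (u (r m) x))\<^sup>2)) \<longlonglongrightarrow> sqrt 0"
      by (intro tendsto_intros)
    then have "(\<lambda>m. sqrt (v x) - sqrt (u (r m) x)) \<longlonglongrightarrow> 0"
      by (simp add: tendsto_rabs_zero_iff)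
    then have "(\<lambda>m. (sqrt (v x) - (sqrt (v x) - sqrt (u (r m) x)))\<^sup>2) \<longlonglongrightarrow> (sqrt (v x) - 0)\<^sup>2"
      by (intro tendsto_intros)
    then show ?case
      using densitiesD(2)[OF vd] densitiesD(2)[OF ud] by simp
  qed
  moreover have "(\<lambda>m. hellinger v (u (r m))) \<longlonglongrightarrow> 0"
    using LIMSEQ_subseq_LIMSEQ[OF lim r(1)] by (simp add: o_def)
  ultimately show ?thesis using u(1) by (intro exI[of _ "u \<circ> r"]) auto
qed

text \<open>The observations have a Lebesgue density, so they almost surely avoid the null set where
  the approximating sequence fails to converge.\<close>

lemma AE_sample_law:
  assumes s: "s \<in> densities" and P: "AE x in lborel. P x"
  shows "AE X in sample_law n s. \<forall>i\<in>{1..n}. P (X i)"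
proof -
  interpret real_distribution "density lborel (\<lambda>x. ennreal (s x))" by (rule real_distribution_density[OF s])
  note [measurable] = densitiesD(1)[OF s]
  have "AE x in density lborel (\<lambda>x. ennreal (s x)). P x"
    using P by (subst AE_density) (auto elim: eventually_mono)
  then have "AE X in sample_law n s. P (X i)" if "i \<in> {1..n}" for i
    unfolding sample_law_def using that prob_space_axioms by (intro AE_PiM_component) auto
  then show ?thesis by (intro AE_finite_allI) auto
qed

text \<open>Both parts of the statistic are upper semicontinuous in the first argument uniformly in
  the second, so \<open>m\<close> is chosen before \<open>t\<close>; it may depend on
  \<open>X\<close>.\<close>

lemma rho_T_perturb:
  assumes v: "v \<in> densities" and u: "\<And>m. u m \<in> densities"
    and lim: "(\<lambda>m. hellinger v (u m)) \<longlonglongrightarrow> 0"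
    and X: "\<And>i. i \<in> {1..n} \<Longrightarrow> (\<lambda>m. u m (X i)) \<longlonglongrightarrow> v (X i)" and n: "0 < n" and \<eta>: "0 < \<eta>"
  shows "\<exists>m. \<forall>t\<in>densities. rho_T n X (u m) t \<le> rho_T n X v t + \<eta>"
proof -
  \<comment> \<open>Of the factor 7, six come from \<open>n / 2 * 12 e\<close> in the midpoint gap
    and one from the sum of \<open>n\<close> scores.\<close>
  define e where "e = min 1 (\<eta> / (7 * real n))"
  have e: "0 < e" "e \<le> 1" "7 * real n * e \<le> \<eta>"
    using n \<eta> by (auto simp: e_def min_def field_simps)
  have "eventually (\<lambda>m. \<forall>i\<in>{1..n}. \<forall>b\<ge>0. score (u m (X i)) b \<le> score (v (X i)) b + e) sequentially"
    using X e(1) densitiesD(2)[OF v] densitiesD(2)[OF u]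
    by (intro eventually_ball_finite ballI score_eventually_le) auto
  moreover have "eventually (\<lambda>m. hellinger v (u m) < e) sequentially"
    using lim e(1) by (rule order_tendstoD)
  ultimately have "eventually (\<lambda>m. (\<forall>i\<in>{1..n}. \<forall>b\<ge>0. score (u m (X i)) b \<le> score (v (X i)) b + e)
      \<and> hellinger v (u m) < e) sequentially"
    by (rule eventually_conj)
  then have "\<exists>m. (\<forall>i\<in>{1..n}. \<forall>b\<ge>0. score (u m (X i)) b \<le> score (v (X i)) b + e) \<and> hellinger v (u m) < e"
    unfolding eventually_sequentially by blast
  then obtain m where m: "\<And>i b. i \<in> {1..n} \<Longrightarrow> 0 \<le> b \<Longrightarrow> score (u m (X i)) b \<le> score (v (X i)) b + e"
    "hellinger v (u m) < e"
    by blast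
  have "rho_T n X (u m) t \<le> rho_T n X v t + \<eta>" if t: "t \<in> densities" for t
  proof -
    have gap: "midpoint_gap (u m) t \<le> midpoint_gap v t + 12 * e"
      using m(2) by (intro midpoint_gap_perturb v u t e) auto
    have "(\<Sum>i=1..n. score (u m (X i)) (t (X i))) \<le> (\<Sum>i=1..n. score (v (X i)) (t (X i)) + e)"
      using m(1) densitiesD(2)[OF t] by (intro sum_mono) auto
    also have "\<dots> = (\<Sum>i=1..n. score (v (X i)) (t (X i))) + real n * e"
      by (simp add: sum.distrib)
    finally have "1 / sqrt 2 * (\<Sum>i=1..n. score (u m (X i)) (t (X i)))
        \<le> 1 / sqrt 2 * ((\<Sum>i=1..n. score (v (X i)) (t (X i))) + real n * e)"
      by (rule mult_left_mono) simp
    then have "1 / sqrt 2 * (\<Sum>i=1..n. score (u m (X i)) (t (X i)))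
        \<le> 1 / sqrt 2 * (\<Sum>i=1..n. score (v (X i)) (t (X i))) + 1 / sqrt 2 * (real n * e)"
      by (simp only: distrib_left)
    moreover have "1 / sqrt 2 * (real n * e) \<le> 1 * (real n * e)"
      using e by (intro mult_right_mono) auto
    moreover have "real n / 2 * midpoint_gap (u m) t \<le> real n / 2 * midpoint_gap v t + 6 * (real n * e)"
    proof -
      have "real n / 2 * midpoint_gap (u m) t \<le> real n / 2 * (midpoint_gap v t + 12 * e)"
        using gap by (intro mult_left_mono) auto
      then show ?thesis by (simp add: algebra_simps)
    qed
    ultimately show ?thesis
      using e(3) unfolding rho_T_eq[OF u t] rho_T_eq[OF v t] by linarith
  qed
  then show ?thesis by blast
qed

section \<open>Near minimizers of the criterion and their limits\<close>

lemma rho_T_swap: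
  assumes "t \<in> densities" "t' \<in> densities"
  shows "rho_T n X t' t = - rho_T n X t t'"
proof -
  have "midpoint_gap t' t = - midpoint_gap t t'"
    by (simp add: midpoint_gap_def add.commute)
  then show ?thesis
    unfolding rho_T_eq[OF assms] rho_T_eq[OF assms(2,1)] score_swap[of "t' _"]
    by (simp add: sum_negf)
qed

text \<open>Provides the boundedness under which the real suprema in \<open>rho_Upsilon\<close> are
  genuine.\<close>

lemma rho_T_le:
  assumes "t \<in> densities" "t' \<in> densities"
  shows "rho_T n X t t' \<le> 2 * real n"
proof -
  have "midpoint_gap t t' \<le> 1"
    using hellinger_sq_le_1[OF assms(1) density_midpoint[OF assms]]
      zero_le_power2[of "hellinger t' (\<lambda>x. (t x + t' x) / 2)"]
    unfolding midpoint_gap_def by linarith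
  then have "real n / 2 * midpoint_gap t t' \<le> real n / 2 * 1" by (intro mult_left_mono) auto
  moreover have "(\<Sum>i=1..n. score (t (X i)) (t' (X i))) \<le> (\<Sum>i=1..n. 1)"
    using abs_score_le_1 densitiesD(2)[OF assms(1)] densitiesD(2)[OF assms(2)]
    by (intro sum_mono) (auto simp: abs_le_iff)
  then have "1 / sqrt 2 * (\<Sum>i=1..n. score (t (X i)) (t' (X i))) \<le> 1 / sqrt 2 * real n"
    by (intro mult_left_mono) auto
  moreover have "1 / sqrt 2 * real n \<le> 1 * real n" by (intro mult_right_mono) auto
  ultimately show ?thesis unfolding rho_T_eq[OF assms] by linarith
qed

text \<open>Since \<open>rho_T\<close> is antisymmetric, an upper bound for \<open>rho_T n X v\<close> uniform in the second argument
  controls both the infimum of the criterion and, from below, its value at a near minimizer. The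
  density \<open>v\<close> need not belong to \<open>S\<close>.\<close>

lemma rho_near_minimizer_bound:
  assumes s: "s \<in> densities" and v: "v \<in> densities" and S: "S \<subseteq> densities" and n: "0 < n"
    and u: "\<And>m. u m \<in> S" and lim: "(\<lambda>m. hellinger v (u m)) \<longlonglongrightarrow> 0"
    and X: "\<And>i. i \<in> {1..n} \<Longrightarrow> (\<lambda>m. u m (X i)) \<longlonglongrightarrow> v (X i)"
    and bound: "\<And>t. t \<in> S \<Longrightarrow> rho_T n X v t \<le> A - real n / 8 * (hellinger s t)\<^sup>2"
    and t: "t \<in> rho_near_minimizers n X S"
  shows "real n / 8 * (hellinger s t)\<^sup>2 \<le> 2 * A + 35.7"
proof (rule field_le_epsilon)
  fix \<eta> :: real assume "0 < \<eta>"
  have uS: "u m \<in> densities" for m using u S by blast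
  have "\<exists>m. \<forall>t\<in>densities. rho_T n X (u m) t \<le> rho_T n X v t + \<eta> / 2"
    by (rule rho_T_perturb[OF v uS lim _ n]) (use X \<open>0 < \<eta>\<close> in auto)
  then obtain m where m: "\<And>t. t \<in> densities \<Longrightarrow> rho_T n X (u m) t \<le> rho_T n X v t + \<eta> / 2"
    by blast
  have tS: "t \<in> S" and t_le: "rho_Upsilon n X S t \<le> (INF t'\<in>S. rho_Upsilon n X S t') + 35.7"
    using t by (auto simp: rho_near_minimizers_def)
  have bdd: "bdd_above (rho_T n X t' ` S)" if "t' \<in> S" for t'
    using that S by (intro bdd_aboveI2[of _ _ "2 * real n"] rho_T_le) auto
  \<comment> \<open>Testing \<open>t'\<close> against itself gives 0, so the criterion is
    nonnegative and its infimum is bounded below.\<close>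
  have Ups0: "0 \<le> rho_Upsilon n X S t'" if "t' \<in> S" for t'
  proof -
    have "t' \<in> densities" using that S by blast
    then have "rho_T n X t' t' = 0" using rho_T_swap[of t' t' n X] by simp
    moreover have "rho_T n X t' t' \<le> rho_Upsilon n X S t'"
      unfolding rho_Upsilon_def using that by (intro cSUP_upper bdd)
    ultimately show ?thesis by simp
  qed
  have "rho_Upsilon n X S (u m) \<le> A + \<eta> / 2"
    unfolding rho_Upsilon_def
  proof (rule cSUP_least)
    fix t' assume t': "t' \<in> S"
    have "rho_T n X (u m) t' \<le> rho_T n X v t' + \<eta> / 2" using m t' S by blast
    also have "rho_T n X v t' \<le> A - real n / 8 * (hellinger s t')\<^sup>2" by (rule bound[OF t'])
    also have "\<dots> \<le> A" by simp
    finally show "rho_T n X (u m) t' \<le> A + \<eta> / 2" by simp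
  qed (use tS in auto)
  moreover have "(INF t'\<in>S. rho_Upsilon n X S t') \<le> rho_Upsilon n X S (u m)"
    using Ups0 by (intro cINF_lower u bdd_belowI2[of _ 0]) auto
  \<comment> \<open>Lower bound on the criterion at \<open>t\<close>: by antisymmetry it is at least
    \<open>- rho_T n X (u m) t\<close>, which contains the distance from \<open>s\<close> to
    \<open>t\<close> with a positive sign.\<close>
  moreover have "rho_T n X t (u m) \<le> rho_Upsilon n X S t"
    unfolding rho_Upsilon_def using u tS by (intro cSUP_upper bdd)
  moreover have "rho_T n X t (u m) = - rho_T n X (u m) t"
    using tS S uS by (intro rho_T_swap) auto
  moreover have "rho_T n X (u m) t \<le> rho_T n X v t + \<eta> / 2" using m tS S by blast
  moreover have "rho_T n X v t \<le> A - real n / 8 * (hellinger s t)\<^sup>2" by (rule bound[OF tS])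
  ultimately show "real n / 8 * (hellinger s t)\<^sup>2 \<le> 2 * A + 35.7 + \<eta>" using t_le by linarith
qed

text \<open>Passing from near minimizers to their limits costs a factor 2 in the triangle inequality
  for squares, whence \<open>16 = 2 * 8\<close>.\<close>

lemma rho_closure_bound:
  assumes s: "s \<in> densities" and v: "v \<in> densities" and S: "S \<subseteq> densities" and n: "0 < n"
    and u: "\<And>m. u m \<in> S" and lim: "(\<lambda>m. hellinger v (u m)) \<longlonglongrightarrow> 0"
    and X: "\<And>i. i \<in> {1..n} \<Longrightarrow> (\<lambda>m. u m (X i)) \<longlonglongrightarrow> v (X i)"
    and bound: "\<And>t. t \<in> S \<Longrightarrow> rho_T n X v t \<le> A - real n / 8 * (hellinger s t)\<^sup>2"
    and r: "r \<in> hellinger_closure (rho_near_minimizers n X S)"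
  shows "(hellinger s r)\<^sup>2 \<le> 16 / real n * (2 * A + 35.7)"
proof (rule field_le_epsilon)
  fix \<epsilon> :: real assume "0 < \<epsilon>"
  then have "0 < sqrt (\<epsilon> / 2)" by simp
  then obtain t where t: "t \<in> rho_near_minimizers n X S" "hellinger r t < sqrt (\<epsilon> / 2)"
    using r unfolding hellinger_closure_def by blast
  have rd: "r \<in> densities" and td: "t \<in> densities"
    using r t S by (auto simp: hellinger_closure_def rho_near_minimizers_def)
  have "(hellinger r t)\<^sup>2 \<le> (sqrt (\<epsilon> / 2))\<^sup>2"
    using t(2) hellinger_nonneg by (intro power_mono) auto
  then have "2 * (hellinger t r)\<^sup>2 \<le> \<epsilon>"
    using \<open>0 < \<epsilon>\<close> by (simp add: hellinger_commute)
  moreover have "(hellinger s r)\<^sup>2 \<le> 2 * (hellinger s t)\<^sup>2 + 2 * (hellinger t r)\<^sup>2"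
    by (rule hellinger_sq_triangle[OF s td rd])
  moreover have "2 * (hellinger s t)\<^sup>2 \<le> 16 / real n * (2 * A + 35.7)"
    using rho_near_minimizer_bound[OF s v S n u lim X bound t(1)] n by (simp add: field_simps)
  ultimately show "(hellinger s r)\<^sup>2 \<le> 16 / real n * (2 * A + 35.7) + \<epsilon>" by linarith
qed

text \<open>Ensures that the infimum in \<open>hellinger_set\<close> is over a nonempty class.
  Adjacent steps may have equal heights, so one uniform block cut at the integers 1 to
  \<open>D + 1\<close> qualifies.\<close>

lemma uniform_step_density:
  assumes "1 \<le> D"
  shows "\<exists>t. t \<in> step_densities D \<inter> decreasing_densities"
proof -
  define t :: "real \<Rightarrow> real" where "t = (\<lambda>y. 1 / real D * indicator {1<..real D + 1} y)"
  have "(\<integral>\<^sup>+y. ennreal (t y) \<partial>lborel) = (\<integral>\<^sup>+y. ennreal (1 / real D) * indicator {1<..real D + 1} y \<partial>lborel)"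
    unfolding t_def by (intro nn_integral_cong) (auto simp: indicator_def)
  also have "\<dots> = 1"
    using assms by (simp add: nn_integral_cmult_indicator flip: ennreal_mult)
  finally have t: "t \<in> densities" by (auto simp: densities_def t_def)
  have ind: "(\<Sum>j=1..k. indicator {real j<..real (j + 1)} y) = (indicator {1<..real k + 1} y :: real)" for k y
    by (induction k) (auto simp: indicator_def)
  have "t \<in> step_densities D"
    unfolding step_densities_def mem_Collect_eq
  proof (intro conjI exI t)
    show "strict_mono_on {1..D + 1} real" by (auto intro: strict_mono_onI)
    show "\<forall>j\<in>{1..D}. 0 \<le> 1 / real D" by simp
    show "t = (\<lambda>y. \<Sum>j=1..D. 1 / real D * indicator {real j<..real (j + 1)} y)"
      unfolding t_def sum_distrib_left[symmetric] ind ..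
  qed
  moreover have "t \<in> decreasing_densities"
  proof -
    define f :: "real \<Rightarrow> real" where "f = (\<lambda>y. 1 / real D * indicator {..real D + 1} y)"
    have tf: "t = (\<lambda>y. f y * indicator {1<..} y)" by (auto simp: t_def f_def indicator_def)
    have "(LINT y:{1<..}|lborel. f y) = (LINT y|lborel. t y)"
      unfolding set_lebesgue_integral_def tf by (simp add: mult.commute)
    then have "(LINT y:{1<..}|lborel. f y) = 1" using densitiesD(4)[OF t] by simp
    moreover have "antimono_on {1<..} f"
      by (auto simp: monotone_on_def f_def indicator_def)
    moreover have "\<forall>y\<in>{1<..}. 0 \<le> f y" by (auto simp: f_def)
    ultimately show ?thesis using t tf unfolding decreasing_densities_def by blast
  qed
  ultimately show ?thesis by blast
qed

text \<open>Outside the exceptional event the deterministic bound applies; inside it the squared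
  distance is at most 1, and the event has probability at most \<open>2 D / n\<close>.\<close>

lemma rho_estimator_risk_step:
  assumes shat: "rho_estimator n decreasing_densities shat" and s: "s \<in> densities"
    and D: "1 \<le> D" "D \<le> n" and v: "v \<in> step_densities D" "v \<in> decreasing_densities"
  shows "(LINT X|sample_law n s. (hellinger s (shat X))\<^sup>2)
     \<le> 400000 * ((hellinger s v)\<^sup>2 + real D / real n * (log_plus (real n / real D)) ^ 3)"
proof -
  define w where "w = real D / real n * (log_plus (real n / real D)) ^ 3"
  have n: "0 < n" "0 < real n" using D by auto
  have "real D / real n * 1 \<le> w"
    unfolding w_def using log_plus_ge by (intro mult_left_mono one_le_power) auto
  then have w: "real D / real n \<le> w" "1 / real n \<le> w" "0 \<le> w"
    using D n by (auto intro: order_trans[rotated] simp: divide_right_mono)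
  obtain S where S: "S \<subseteq> decreasing_densities" "decreasing_densities \<subseteq> hellinger_closure S"
    and cl: "\<And>X. X \<in> space (Pi\<^sub>M {1..n} (\<lambda>_. borel)) \<Longrightarrow> shat X \<in> hellinger_closure (rho_near_minimizers n X S)"
    using shat by (auto simp: rho_estimator_def)
  have Sd: "S \<subseteq> densities" and vd: "v \<in> densities"
    using S v by (auto simp: decreasing_densities_def)
  have sp: "space (sample_law n s) = space (Pi\<^sub>M {1..n} (\<lambda>_. borel))"
    by (simp add: sample_law_def space_PiM)
  interpret M: real_distribution "density lborel (\<lambda>x. ennreal (s x))" by (rule real_distribution_density[OF s])
  interpret Q: prob_space "sample_law n s"
    unfolding sample_law_def by (rule prob_space_PiM) (rule M.prob_space_axioms)
  obtain B where B: "B \<in> sets (sample_law n s)" "measure (sample_law n s) B \<le> 2 * real D / real n"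
    and ev: "\<And>X t. X \<in> space (sample_law n s) - B \<Longrightarrow> t \<in> decreasing_densities \<Longrightarrow>
       rho_T n X v t \<le> real n * (2 * (hellinger s v)\<^sup>2 - (hellinger s t)\<^sup>2 / 8 + 10241 * w)"
    using score_deviation_event[OF s v(1) D] unfolding w_def by blast
  obtain u where u: "\<And>m. u m \<in> S" "(\<lambda>m. hellinger v (u m)) \<longlonglongrightarrow> 0"
    "AE x in lborel. (\<lambda>m. u m x) \<longlonglongrightarrow> v x"
    using hellinger_closure_AE_sequence[of v S] v S Sd by blast
  \<comment> \<open>The constants are \<open>64 = 16 * 2 * 2\<close> and
    \<open>328288 = 16 * 2 * 10241 + 576\<close>, where 576 dominates
    \<open>16 * 35.7 = 571.2\<close>.\<close>
  define b where "b = 64 * (hellinger s v)\<^sup>2 + 328288 * w"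
  have b0: "0 \<le> b" using w by (simp add: b_def)
  have bound: "AE X in sample_law n s. (hellinger s (shat X))\<^sup>2 \<le> b + indicator B X"
    using AE_sample_law[OF s u(3), of n] AE_space
  proof eventually_elim
    case (elim X)
    have r: "shat X \<in> hellinger_closure (rho_near_minimizers n X S)"
      using cl elim(2) sp by simp
    show ?case
    proof (cases "X \<in> B")
      case True
      have "shat X \<in> densities" using r by (simp add: hellinger_closure_def)
      then show ?thesis using hellinger_sq_le_1[OF s, of "shat X"] b0 True by simp
    next
      case False
      define A where "A = real n * (2 * (hellinger s v)\<^sup>2 + 10241 * w)"
      have "(hellinger s (shat X))\<^sup>2 \<le> 16 / real n * (2 * A + 35.7)"
      proof (rule rho_closure_bound[OF s vd Sd n(1) u(1,2) _ _ r])
        show "(\<lambda>m. u m (X i)) \<longlonglongrightarrow> v (X i)" if "i \<in> {1..n}" for i using elim(1) that by blast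
        show "rho_T n X v t \<le> A - real n / 8 * (hellinger s t)\<^sup>2" if "t \<in> S" for t
          using ev[of X t] elim(2) False that S(1) by (auto simp: A_def algebra_simps)
      qed
      also have "\<dots> = 64 * (hellinger s v)\<^sup>2 + 327712 * w + 571.2 * (1 / real n)"
        using n by (simp add: A_def field_simps)
      also have "\<dots> \<le> b" using w unfolding b_def by simp
      finally show ?thesis using False by simp
    qed
  qed
  \<comment> \<open>A non-integrable function has integral 0 by convention, which makes that case
    trivial.\<close>
  have "(LINT X|sample_law n s. (hellinger s (shat X))\<^sup>2) \<le> b + measure (sample_law n s) B"
  proof (cases "integrable (sample_law n s) (\<lambda>X. (hellinger s (shat X))\<^sup>2)")
    case True
    have iB: "integrable (sample_law n s) (indicat_real B)"
      using B(1) by (intro integrable_real_indicator) (auto simp: less_top[symmetric])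
    have "(LINT X|sample_law n s. (hellinger s (shat X))\<^sup>2) \<le> (LINT X|sample_law n s. b + indicator B X)"
      using bound True iB by (intro integral_mono_AE) auto
    also have "\<dots> = b + measure (sample_law n s) B"
      using iB B(1) by (simp add: Q.prob_space)
    finally show ?thesis .
  qed (use b0 in \<open>simp add: not_integrable_integral_eq\<close>)
  also have "\<dots> \<le> 400000 * ((hellinger s v)\<^sup>2 + w)"
  proof -
    have "measure (sample_law n s) B \<le> 2 * w" using B(2) w(1) by simp
    moreover have "0 \<le> (hellinger s v)\<^sup>2" by simp
    ultimately show ?thesis using w(3) unfolding b_def distrib_left by linarith
  qed
  finally show ?thesis by (simp add: w_def)
qed

lemma rho_estimator_risk_le_1:
  assumes shat: "rho_estimator n Sbar shat" and s: "s \<in> densities"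
  shows "(LINT X|sample_law n s. (hellinger s (shat X))\<^sup>2) \<le> 1"
proof (cases "integrable (sample_law n s) (\<lambda>X. (hellinger s (shat X))\<^sup>2)")
  case True
  interpret M: real_distribution "density lborel (\<lambda>x. ennreal (s x))" by (rule real_distribution_density[OF s])
  interpret Q: prob_space "sample_law n s"
    unfolding sample_law_def by (rule prob_space_PiM) (rule M.prob_space_axioms)
  have "(hellinger s (shat X))\<^sup>2 \<le> 1" if "X \<in> space (sample_law n s)" for X
  proof -
    have "X \<in> space (Pi\<^sub>M {1..n} (\<lambda>_. borel))"
      using that by (simp add: sample_law_def space_PiM)
    then have "shat X \<in> densities"
      using shat by (auto simp: rho_estimator_def hellinger_closure_def)
    then show ?thesis by (rule hellinger_sq_le_1[OF s])
  qed
  then show ?thesis using True by (intro Q.integral_le_const AE_I2) auto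
qed (simp add: not_integrable_integral_eq)

theorem theorem1:
  "\<exists>C::real. 0 < C \<and> C \<le> 1 \<and>
     (\<forall>n::nat. n \<ge> 3 \<longrightarrow>
       (\<forall>shat. rho_estimator n decreasing_densities shat \<longrightarrow>
         (\<forall>s\<in>densities.
            C * (LINT X|sample_law n s. (hellinger s (shat X))\<^sup>2)
            \<le> (INF D\<in>{1::nat..}.
                  (hellinger_set s (step_densities D \<inter> decreasing_densities))\<^sup>2
                  + real D / real n * (log_plus (real n / real D)) ^ 3))))"
proof (intro exI[of _ "1 / 400000"] conjI allI impI ballI)
  fix n :: nat and shat s
  assume n: "n \<ge> 3" and shat: "rho_estimator n decreasing_densities shat" and s: "s \<in> densities"
  \<comment> \<open>The factor is the inverse of the constant in
    \<open>rho_estimator_risk_step\<close>.\<close>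
  define R where "R = 1 / 400000 * (LINT X|sample_law n s. (hellinger s (shat X))\<^sup>2)"
  show "R \<le> (INF D\<in>{1::nat..}. (hellinger_set s (step_densities D \<inter> decreasing_densities))\<^sup>2
                  + real D / real n * (log_plus (real n / real D)) ^ 3)"
  proof (rule cINF_greatest)
    fix D :: nat assume "D \<in> {1..}"
    then have D: "1 \<le> D" by simp
    define w where "w = real D / real n * (log_plus (real n / real D)) ^ 3"
    let ?A = "step_densities D \<inter> decreasing_densities"
    show "R \<le> (hellinger_set s ?A)\<^sup>2 + w"
    proof (cases "D \<le> n")
      case True
      have "R - w \<le> (hellinger s v)\<^sup>2" if "v \<in> ?A" for v
        using rho_estimator_risk_step[OF shat s D True, of v] that by (simp add: R_def w_def)
      \<comment> \<open>Roots are taken because \<open>hellinger_set\<close> is an infimum of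
        unsquared distances. If \<open>R < w\<close>, the root is negative, \<open>sqrt\<close>
        being extended as an odd function, and the bound is trivial.\<close>
      then have "sqrt (R - w) \<le> hellinger s v" if "v \<in> ?A" for v
        using that hellinger_nonneg by (intro real_le_lsqrt) auto
      then have "sqrt (R - w) \<le> hellinger_set s ?A"
        unfolding hellinger_set_def using uniform_step_density[OF D] by (intro cINF_greatest) auto
      then have "R - w \<le> (hellinger_set s ?A)\<^sup>2" by (rule sqrt_le_D)
      then show ?thesis by simp
    next
      case False
      \<comment> \<open>For \<open>D > n\<close> the second term alone exceeds the trivial risk
        bound 1.\<close>
      have "1 * 1 \<le> w"
        unfolding w_def using False n log_plus_ge by (intro mult_mono one_le_power) auto
      moreover have "R \<le> 1"
        using rho_estimator_risk_le_1[OF shat s] by (simp add: R_def)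
      ultimately show ?thesis by (simp add: add_increasing)
    qed
  qed simp
qed auto

end
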